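(* For any $k\in\mathbb{Z}$ and any $\gamma=\begin{pmatrix}a&b\\c&d\end{pmatrix}\in\Gamma$, $$(y^k|\gamma)=\sum_{u\ge0}\omega_k(u)\,(cz+d)^{-k}\left(\frac{c}{cz+d}\right)^{u}y^{2u+k},$$ where $\omega_k(0)=1$ and $\omega_k(u)=\dfrac{1}{4^u\,u!}\displaystyle\prod_{i=0}^{u-1}(k+2i)(k+2i+2)$ for any $u\ge1$.
   Context: $\Gamma$ is a subgroup of $\mathrm{SL}(2,\mathbb{C})$ and $R$ is a commutative $\mathbb{C}$-algebra of functions in one variable $z$, which is a domain, such that: (i) $\Gamma$ acts on the right on $R$ by automorphisms $(f\cdot\gamma)(z)=f\left(\frac{az+b}{cz+d}\right)$ for $\gamma=\begin{pmatrix}a&b\\c&d\end{pmatrix}$; (ii) the function $z\mapsto cz+d$ is an invertible element of $R$ for every $\gamma\in\Gamma$; (iii) $R$ is stable under $\partial_z=\frac{d}{dz}$, which is nonzero on $R$. Put $d_z=-\partial_z$, $\delta_z=\frac12d_z$. $C=R(\!(y;\delta_z)\!)_2$ is the ring of Laurent series $\sum_{i\ge m}f_iy^i$ ($m\in\mathbb{Z}$, $f_i\in R$) with multiplication determined by $yf=\sum_{k\ge0}\frac{(2k)!}{2^k(k!)^2}\delta_z^k(f)y^{2k+1}$ for $f\in R$. With $x=y^2$ it contains the subring $B=R(\!(x;d_z)\!)$ of Laurent series in $x$, where $xf=\sum_{n\ge0}d_z^n(f)x^{n+1}$, equivalently $x^{-1}f=fx^{-1}+\partial_z(f)$. The homographic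 action extends to an action by automorphisms $q\mapsto(q|\gamma)$ on $C$ defined by letting $(y|\gamma)$ be the square root in $C$ of $x(cz+d)^{-2}$ whose term of minimal valuation is $(cz+d)^{-1}y$; explicitly $(\sum f_ny^n|\gamma)=\sum(f_n\cdot\gamma)(y|\gamma)^n$. It satisfies $(x^{-1}|\gamma)=(cz+d)^2x^{-1}$. *)

theory Defs
  imports "HOL-Analysis.Analysis" "HOL-Algebra.Ring"
    "HOL-Computational_Algebra.Formal_Laurent_Series"
begin

definition SL2C :: "(complex^2^2) monoid" where
  "SL2C = \<lparr>carrier = {A. det A = 1}, mult = (**), one = mat 1\<rparr>"

definition homography :: "complex^2^2 \<Rightarrow> complex \<Rightarrow> complex" where
  "homography \<gamma> z = (\<gamma>$1$1 * z + \<gamma>$1$2) / (\<gamma>$2$1 * z + \<gamma>$2$2)"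

text \<open>
  Functions such as \<open>f ((a z + b) / (c z + d))\<close> or rational functions have to be compared away from
  their singularities. Two functions on the open set \<open>D\<close> are therefore identified when they agree on
  a dense open subset of \<open>D\<close>; for holomorphic functions on \<open>D\<close> this is equality on \<open>D\<close>, and for
  meromorphic functions it is equality as meromorphic functions.
\<close>

definition generically :: "complex set \<Rightarrow> (complex \<Rightarrow> bool) \<Rightarrow> bool" where
  "generically D P \<longleftrightarrow> (\<exists>U. open U \<and> U \<subseteq> D \<and> D \<subseteq> closure U \<and> (\<forall>z\<in>U. P z))"

text \<open>
  An algebra of functions is given by a type \<open>'a\<close> together with the map \<open>ev\<close> sending an element to the
  function it stands for. \<open>is_elt D ev h\<close> says that the function \<open>h\<close> belongs to the algebra, and
  \<open>elt D ev h\<close> is then the element it defines (unique by \<open>ev_inject\<close> below).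
\<close>

definition is_elt :: "complex set \<Rightarrow> ('a \<Rightarrow> complex \<Rightarrow> complex) \<Rightarrow> (complex \<Rightarrow> complex) \<Rightarrow> bool" where
  "is_elt D ev h \<longleftrightarrow> (\<exists>f. generically D (\<lambda>z. ev f z = h z))"

definition elt :: "complex set \<Rightarrow> ('a \<Rightarrow> complex \<Rightarrow> complex) \<Rightarrow> (complex \<Rightarrow> complex) \<Rightarrow> 'a" where
  "elt D ev h = (THE f. generically D (\<lambda>z. ev f z = h z))"

definition scal :: "complex set \<Rightarrow> ('a \<Rightarrow> complex \<Rightarrow> complex) \<Rightarrow> complex \<Rightarrow> 'a" where
  "scal D ev a = elt D ev (\<lambda>_. a)"

definition pderiv_z :: "complex set \<Rightarrow> ('a \<Rightarrow> complex \<Rightarrow> complex) \<Rightarrow> 'a \<Rightarrow> 'a" where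
  "pderiv_z D ev f = elt D ev (deriv (ev f))"

definition act :: "complex set \<Rightarrow> ('a \<Rightarrow> complex \<Rightarrow> complex) \<Rightarrow> 'a \<Rightarrow> complex^2^2 \<Rightarrow> 'a" where
  "act D ev f \<gamma> = elt D ev (\<lambda>z. ev f (homography \<gamma> z))"

text \<open>The element \<open>c z + d\<close>.\<close>
definition autf :: "complex set \<Rightarrow> ('a \<Rightarrow> complex \<Rightarrow> complex) \<Rightarrow> complex^2^2 \<Rightarrow> 'a" where
  "autf D ev \<gamma> = elt D ev (\<lambda>z. \<gamma>$2$1 * z + \<gamma>$2$2)"

text \<open>
  That \<open>act\<close> is a right action by algebra automorphisms and that \<open>pderiv_z\<close> is a derivation
  are consequences of the assumptions.
\<close>

locale homographic_algebra =
  fixes D :: "complex set"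
    and ev :: "'a::idom \<Rightarrow> complex \<Rightarrow> complex"
    and \<Gamma> :: "(complex^2^2) set"
  assumes open_D: "open D"
    and subgroup_\<Gamma>: "subgroup \<Gamma> SL2C"
    and homography_D: "\<lbrakk>\<gamma> \<in> \<Gamma>; z \<in> D; \<gamma>$2$1 * z + \<gamma>$2$2 \<noteq> 0\<rbrakk> \<Longrightarrow> homography \<gamma> z \<in> D"
    and ev_inject: "generically D (\<lambda>z. ev f z = ev g z) \<Longrightarrow> f = g"
    and ev_differentiable: "generically D (\<lambda>z. ev f field_differentiable at z)"
    and ev_add: "generically D (\<lambda>z. ev (f + g) z = ev f z + ev g z)"
    and ev_mult: "generically D (\<lambda>z. ev (f * g) z = ev f z * ev g z)"
    and is_elt_const: "is_elt D ev (\<lambda>_. a)"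
    and is_elt_act: "\<gamma> \<in> \<Gamma> \<Longrightarrow> is_elt D ev (\<lambda>z. ev f (homography \<gamma> z))"
    and is_elt_autf: "\<gamma> \<in> \<Gamma> \<Longrightarrow> is_elt D ev (\<lambda>z. \<gamma>$2$1 * z + \<gamma>$2$2)"
    and autf_unit: "\<gamma> \<in> \<Gamma> \<Longrightarrow> autf D ev \<gamma> dvd 1"
    and is_elt_deriv: "is_elt D ev (deriv (ev f))"
    and pderiv_z_nonzero: "\<exists>f. pderiv_z D ev f \<noteq> 0"

definition unit_inv :: "'a::idom \<Rightarrow> 'a" where
  "unit_inv a = (THE b. a * b = 1)"

definition unit_powi :: "'a::idom \<Rightarrow> int \<Rightarrow> 'a" where
  "unit_powi a k = (if k \<ge> 0 then a ^ nat k else unit_inv a ^ nat (- k))"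

definition delta_z :: "complex set \<Rightarrow> ('a::idom \<Rightarrow> complex \<Rightarrow> complex) \<Rightarrow> 'a \<Rightarrow> 'a" where
  "delta_z D ev f = scal D ev (1/2) * (- pderiv_z D ev f)"

text \<open>
  The elements of the ring \<open>C\<close> are the Laurent series \<open>\<Sum>i. f\<^sub>i y^i\<close> with coefficients on the left,
  represented by the additive group of \<open>'a fls\<close> (with \<open>y\<close> as \<open>fls_X\<close>); the commutative product of
  \<open>'a fls\<close> is not used. Left multiplication by \<open>y\<close> is
  \<open>y (\<Sum>i. f\<^sub>i y^i) = \<Sum>i. \<Sum>k. (2k)!/(2^k (k!)^2) \<delta>^k(f\<^sub>i) y^(i+2k+1)\<close>; it is bijective, and left
  multiplication by \<open>y^i\<close>, for any integer \<open>i\<close>, is its \<open>i\<close>-th (possibly negative) iterate. In the sums below all terms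
  outside the given ranges vanish.
\<close>

definition lmult_y :: "complex set \<Rightarrow> ('a::idom \<Rightarrow> complex \<Rightarrow> complex) \<Rightarrow> 'a fls \<Rightarrow> 'a fls" where
  "lmult_y D ev g = Abs_fls (\<lambda>n. \<Sum>k\<le>nat (n - 1 - fls_subdegree g).
     scal D ev (fact (2*k) / (2^k * (fact k)^2))
       * (delta_z D ev ^^ k) (fls_nth g (n - 1 - 2 * int k)))"

definition lmult_y_powi ::
  "complex set \<Rightarrow> ('a::idom \<Rightarrow> complex \<Rightarrow> complex) \<Rightarrow> int \<Rightarrow> 'a fls \<Rightarrow> 'a fls" where
  "lmult_y_powi D ev i =
     (if i \<ge> 0 then lmult_y D ev ^^ nat i else inv_into UNIV (lmult_y D ev) ^^ nat (- i))"

definition skew_mult ::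
  "complex set \<Rightarrow> ('a::idom \<Rightarrow> complex \<Rightarrow> complex) \<Rightarrow> 'a fls \<Rightarrow> 'a fls \<Rightarrow> 'a fls" where
  "skew_mult D ev f g = Abs_fls (\<lambda>n. \<Sum>i = fls_subdegree f..n - fls_subdegree g.
     fls_nth f i * fls_nth (lmult_y_powi D ev i g) n)"

definition skew_laurent ::
  "complex set \<Rightarrow> ('a::idom \<Rightarrow> complex \<Rightarrow> complex) \<Rightarrow> 'a fls ring" where
  "skew_laurent D ev =
     \<lparr>carrier = UNIV, mult = skew_mult D ev, one = 1, zero = 0, add = (+)\<rparr>"

definition yact :: "complex set \<Rightarrow> ('a::idom \<Rightarrow> complex \<Rightarrow> complex) \<Rightarrow> complex^2^2 \<Rightarrow> 'a fls" where
  "yact D ev \<gamma> = (THE q.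
     q \<otimes>\<^bsub>skew_laurent D ev\<^esub> q
       = (fls_X \<otimes>\<^bsub>skew_laurent D ev\<^esub> fls_X)
           \<otimes>\<^bsub>skew_laurent D ev\<^esub> fls_const (unit_powi (autf D ev \<gamma>) (- 2))
     \<and> fls_subdegree q = 1 \<and> fls_nth q 1 = unit_powi (autf D ev \<gamma>) (- 1))"

text \<open>
  The series \<open>\<Sum>n. (f\<^sub>n\<cdot>\<gamma>) (y|\<gamma>)^n\<close>, computed coefficientwise: \<open>(y|\<gamma>)^n\<close> has valuation \<open>n\<close>, so only
  indices \<open>n \<le> m\<close> contribute to the coefficient of \<open>y^m\<close>.
\<close>

definition series_act ::
  "complex set \<Rightarrow> ('a::idom \<Rightarrow> complex \<Rightarrow> complex) \<Rightarrow> 'a fls \<Rightarrow> complex^2^2 \<Rightarrow> 'a fls" where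
  "series_act D ev q \<gamma> = Abs_fls (\<lambda>m. \<Sum>n = fls_subdegree q..m.
     fls_nth (fls_const (act D ev (fls_nth q n) \<gamma>)
       \<otimes>\<^bsub>skew_laurent D ev\<^esub> (yact D ev \<gamma> [^]\<^bsub>skew_laurent D ev\<^esub> n)) m)"

definition omega :: "int \<Rightarrow> nat \<Rightarrow> complex" where
  "omega k u = (if u = 0 then 1 else
     1 / (4^u * fact u) * (\<Prod>i = 0..u - 1. (of_int k + 2 * of_nat i) * (of_int k + 2 * of_nat i + 2)))"

end

theory Submission
  imports Defs
begin

text \<open>
  Write \<open>w = c z + d\<close> and \<open>(a)_k\<close> for the rising factorial. The rule for \<open>y f\<close> is the expansion of
  \<open>(1 - 2 t)^(-1/2)\<close> with \<open>t^k\<close> standing for \<open>\<delta>^k(f) y^(2k+1)\<close>. Multiplying such expansions shows that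
  for every integer \<open>n\<close> left multiplication by \<open>y^n\<close> comes from \<open>(1 - 2 t)^(-n/2)\<close>, that is,
  \<open>y^n f = \<Sum>k. c(n,k) \<delta>^k(f) y^(n+2k)\<close> with \<open>c(n,k) = 2^k (n/2)_k / k!\<close> (\<open>commcoeff\<close>).
  This gives a closed formula for the product of two Laurent series, \<open>sprod\<close>. Its associativity
  (\<open>sprod_assoc\<close>) is the Leibniz rule combined with the Chu-Vandermonde identity
  (\<open>monomial_cocycle\<close>), and associativity in turn shows that iterating left multiplication by \<open>y\<close>
  and its inverse gives the same product (\<open>skew_mult_eq\<close>).

  Let \<open>q_k\<close> be the series claimed to be \<open>(y^k|\<gamma>)\<close> (\<open>ypow\<close>). Since
  \<open>\<delta>^j(w^(-n)) = (n)_j (c/2)^j w^(-n-j)\<close>, the product \<open>q_k q_l\<close> has coefficients of the same shape as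
  \<open>q_(k+l)\<close>, and \<open>q_k q_l = q_(k+l)\<close> (\<open>ypow_add\<close>) becomes a double sum identity for the numbers
  \<open>\<omega>_k(u)\<close>: one summation is Chu-Vandermonde, the other is the Pfaff-Saalschuetz sum
  (\<open>omega_convolution\<close>). Moreover \<open>q_2 = x w^(-2)\<close> (\<open>ypow_2\<close>). Hence \<open>q_1\<close> is a square root of
  \<open>x w^(-2)\<close> with lowest term \<open>w^(-1) y\<close>. A square root is determined by its lowest term
  because the coefficients lie in a domain in which 2 is invertible (\<open>sprod_square_unique\<close>), so
  \<open>(y|\<gamma>) = q_1\<close>. As \<open>k \<mapsto> q_k\<close> turns sums into products, \<open>(y|\<gamma>)^k = q_k\<close> for every integer \<open>k\<close>.

  The assumptions on the algebra of functions are used to see that constants form a copy of the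
  complex numbers, that \<open>\<delta>\<close> is a derivation killing them with \<open>\<delta>(w) = - c/2\<close>, and that \<open>\<gamma>\<close> fixes
  the constants. They concern functions up to equality on a dense open set, so they are handled
  through the filter of dense open subsets of the domain; the one topological input is that
  homographies pull dense open sets back to dense open sets (\<open>eventually_generic_homography\<close>).
\<close>

section \<open>Hypergeometric coefficients\<close>

text \<open>
  The coefficient of \<open>t^k\<close> in \<open>(1 - 2 t)^(-i/2)\<close>.
\<close>
definition commcoeff :: "int \<Rightarrow> nat \<Rightarrow> complex" where
  "commcoeff i k = 2 ^ k * pochhammer (of_int i / 2) k / fact k"

lemma commcoeff_0 [simp]: "commcoeff i 0 = 1"
  by (simp add: commcoeff_def)

lemma commcoeff_0_left: "commcoeff 0 k = (if k = 0 then 1 else 0)"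
  by (simp add: commcoeff_def pochhammer_0_left)

lemma commcoeff_1: "commcoeff 1 k = fact (2 * k) / (2 ^ k * (fact k)\<^sup>2)"
proof -
  have "(2::complex) ^ (2 * k) = 2 ^ k * 2 ^ k"
    by (simp add: mult_2 power_add)
  then show ?thesis
    by (simp add: commcoeff_def fact_double power2_eq_square)
qed

lemma commcoeff_2: "commcoeff 2 k = 2 ^ k"
  by (simp add: commcoeff_def flip: pochhammer_fact)

text \<open>
  The binomial coefficient is the one in the Leibniz rule for \<open>\<delta>^(l+t)\<close>; this is what matches that rule
  with two successive commutations.
\<close>
lemma commcoeff_shift:
  "commcoeff i l * commcoeff (i + 2 * int l) t = of_nat ((l + t) choose l) * commcoeff i (l + t)"
proof -
  have "of_int (i + 2 * int l) / 2 = (of_int i / 2 + of_nat l :: complex)"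
    by simp
  then show ?thesis
    by (simp add: commcoeff_def pochhammer_product' binomial_fact power_add field_simps)
qed

text \<open>
  \<open>(1 - 2 t)^(-i/2) (1 - 2 t)^(-j/2) = (1 - 2 t)^(-(i+j)/2)\<close>, read off coefficientwise; this is the
  Chu-Vandermonde identity.
\<close>
lemma commcoeff_add:
  "commcoeff (i + j) N = (\<Sum>t\<le>N. commcoeff i t * commcoeff j (N - t))"
proof -
  have "commcoeff (i + j) N = 2 ^ N * pochhammer (of_int i / 2 + of_int j / 2) N / fact N"
    by (simp add: commcoeff_def add_divide_distrib)
  also have "\<dots> = (\<Sum>t\<le>N. 2 ^ N * (of_nat (N choose t) * pochhammer (of_int i / 2) t
      * pochhammer (of_int j / 2) (N - t)) / fact N)"
    by (simp only: pochhammer_binomial_sum sum_distrib_left sum_divide_distrib)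
  also have "\<dots> = (\<Sum>t\<le>N. commcoeff i t * commcoeff j (N - t))"
  proof (rule sum.cong[OF refl])
    fix t assume "t \<in> {..N}"
    then have t: "t \<le> N" by simp
    then have "(2::complex) ^ N = 2 ^ t * 2 ^ (N - t)"
      by (simp flip: power_add)
    with t show "2 ^ N * (of_nat (N choose t) * pochhammer (of_int i / 2) t
      * pochhammer (of_int j / 2) (N - t)) / fact N = commcoeff i t * commcoeff j (N - t)"
      by (simp add: commcoeff_def binomial_fact field_simps)
  qed
  finally show ?thesis .
qed

lemma omega_pochhammer:
  "omega k u = pochhammer (of_int k / 2) u * pochhammer (of_int k / 2 + 1) u / fact u"
proof (cases u)
  case (Suc m)
  have "(\<Prod>i = 0..m. (of_int k + 2 * of_nat i) * (of_int k + 2 * of_nat i + 2))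
      = (\<Prod>i = 0..m. 4 * ((of_int k / 2 + of_nat i) * (of_int k / 2 + 1 + of_nat i :: complex)))"
    by (intro prod.cong refl) (simp add: field_simps)
  also have "\<dots> = 4 ^ u * (pochhammer (of_int k / 2) u * pochhammer (of_int k / 2 + 1) u)"
    by (simp add: prod.distrib pochhammer_Suc_prod Suc)
  finally show ?thesis
    by (simp add: omega_def Suc)
qed (simp add: omega_def)

lemma omega_0 [simp]: "omega k 0 = 1"
  by (simp add: omega_def)

text \<open>
  Up to the factor \<open>(a)_m (a+1+2b)_m / m!\<close>, these are the terms of the balanced series
  \<open>3F2(-m, b, b+1; a+1+2b, 1-a-m; 1)\<close>. Keeping the rising factorials in the numerator makes the
  summation valid for all \<open>a\<close> and \<open>b\<close>, including those where the quotient form has vanishing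
  denominators.
\<close>
definition saalschuetz_term :: "'a::field_char_0 \<Rightarrow> 'a \<Rightarrow> nat \<Rightarrow> nat \<Rightarrow> 'a" where
  "saalschuetz_term a b m v = pochhammer a (m - v) * pochhammer (a + 1 + 2 * b + of_nat v) (m - v)
     * pochhammer b v * pochhammer (b + 1) v / (fact (m - v) * fact v)"

text \<open>
  Creative telescoping: the difference of the two sides is a telescoping sum. The certificate \<open>G\<close> was
  chosen to contain the factor \<open>v\<close>, so that \<open>G 0 = 0\<close>, and so that the last term \<open>v = m + 1\<close> of the
  left-hand sum cancels \<open>G (m + 1)\<close>.
\<close>
lemma saalschuetz_recurrence:
  fixes a b :: "'a::field_char_0"
  shows "of_nat (Suc m) * (\<Sum>v\<le>Suc m. saalschuetz_term a b (Suc m) v)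
    = (a + b + of_nat m) * (a + b + of_nat m + 1) * (\<Sum>v\<le>m. saalschuetz_term a b m v)"
proof -
  define G where "G v = of_nat v * pochhammer a (Suc m - v)
     * pochhammer (a + 2 * b + of_nat v) (Suc m - v)
     * pochhammer b v * pochhammer (b + 1) v / (fact (Suc m - v) * fact v)" for v
  have step: "of_nat (Suc m) * saalschuetz_term a b (Suc m) v
      - (a + b + of_nat m) * (a + b + of_nat m + 1) * saalschuetz_term a b m v = G v - G (Suc v)"
    if "v \<le> m" for v
  proof -
    define r where "r = m - v"
    have m: "m = v + r" and diff: "Suc m - v = Suc r" "m - v = r" "Suc m - Suc v = r"
      using that by (auto simp: r_def)
    define P where "P = pochhammer a r * pochhammer (a + 1 + 2 * b + of_nat v) r
      * pochhammer b v * pochhammer (b + 1) v / (fact r * fact v)"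
    have t0: "saalschuetz_term a b m v = P"
      by (simp add: saalschuetz_term_def P_def diff)
    have t1: "saalschuetz_term a b (Suc m) v
        = P * (a + of_nat r) * (a + 1 + 2 * b + of_nat v + of_nat r) / of_nat (Suc r)"
      by (simp add: saalschuetz_term_def P_def diff pochhammer_Suc field_simps)
    have g0: "G v = P * (a + of_nat r) * (a + 2 * b + of_nat v) * of_nat v / of_nat (Suc r)"
    proof -
      have "pochhammer (a + 2 * b + of_nat v) (Suc r)
          = (a + 2 * b + of_nat v) * pochhammer (a + 1 + 2 * b + of_nat v) r"
        by (simp add: pochhammer_rec ac_simps)
      then show ?thesis
        by (simp add: G_def P_def diff pochhammer_Suc[of a] field_simps)
    qed
    have g1: "G (Suc v) = P * (b + of_nat v) * (b + 1 + of_nat v)"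
    proof -
      have shift: "a + 2 * b + of_nat (Suc v) = a + 1 + 2 * b + of_nat v" by simp
      have fact: "of_nat (Suc v) / fact (Suc v) = (1 / fact v :: 'a)"
        by (simp del: of_nat_Suc)
      have "G (Suc v) = of_nat (Suc v) / fact (Suc v) * (pochhammer a r
          * pochhammer (a + 2 * b + of_nat (Suc v)) r
          * pochhammer b (Suc v) * pochhammer (b + 1) (Suc v) / fact r)"
        by (simp add: G_def diff ac_simps del: of_nat_Suc fact_Suc)
      then show ?thesis
        unfolding fact shift pochhammer_Suc by (simp add: P_def ac_simps)
    qed
    have "of_nat (Suc r) \<noteq> (0 :: 'a)"
      by (rule of_nat_neq_0)
    then show ?thesis
      unfolding t0 t1 g0 g1 unfolding m by (simp add: divide_simps del: of_nat_Suc) (simp add: algebra_simps)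
  qed
  have last: "of_nat (Suc m) * saalschuetz_term a b (Suc m) (Suc m) = G (Suc m)"
    by (simp add: saalschuetz_term_def G_def)
  have "G 0 = 0" by (simp add: G_def)
  have "of_nat (Suc m) * (\<Sum>v\<le>Suc m. saalschuetz_term a b (Suc m) v)
      - (a + b + of_nat m) * (a + b + of_nat m + 1) * (\<Sum>v\<le>m. saalschuetz_term a b m v)
      = (\<Sum>v\<le>m. of_nat (Suc m) * saalschuetz_term a b (Suc m) v
          - (a + b + of_nat m) * (a + b + of_nat m + 1) * saalschuetz_term a b m v) + G (Suc m)"
    by (simp only: sum.atMost_Suc distrib_left sum_distrib_left sum_subtractf last) simp
  also have "\<dots> = (\<Sum>v\<le>m. G v - G (Suc v)) + G (Suc m)"
    by (intro arg_cong2[where f = "(+)"] sum.cong refl step) simp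
  also have "\<dots> = 0"
    using \<open>G 0 = 0\<close> by (simp only: sum_telescope) simp
  finally show ?thesis by simp
qed

lemma saalschuetz_sum:
  fixes a b :: "'a::field_char_0"
  shows "(\<Sum>v\<le>m. saalschuetz_term a b m v)
    = pochhammer (a + b) m * pochhammer (a + b + 1) m / fact m"
proof (induction m)
  case 0
  show ?case by (simp add: saalschuetz_term_def)
next
  case (Suc m)
  have "of_nat (Suc m) * (\<Sum>v\<le>Suc m. saalschuetz_term a b (Suc m) v)
      = of_nat (Suc m) * (pochhammer (a + b) (Suc m) * pochhammer (a + b + 1) (Suc m) / fact (Suc m))"
    unfolding saalschuetz_recurrence Suc.IH pochhammer_Suc fact_Suc
    by (simp add: ac_simps del: of_nat_Suc)
  then show ?case
    using mult_left_cancel[OF of_nat_neq_0] by blast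
qed

lemma pochhammer_convolution:
  fixes a b :: "'a::field_char_0"
  shows "(\<Sum>u\<le>n. pochhammer a u / fact u * (pochhammer b (n - u) / fact (n - u)))
    = pochhammer (a + b) n / fact n"
proof -
  have "pochhammer (a + b) n / fact n
      = (\<Sum>u\<le>n. of_nat (n choose u) * pochhammer a u * pochhammer b (n - u) / fact n)"
    by (simp only: pochhammer_binomial_sum sum_divide_distrib)
  also have "\<dots> = (\<Sum>u\<le>n. pochhammer a u / fact u * (pochhammer b (n - u) / fact (n - u)))"
    by (intro sum.cong refl) (simp add: binomial_fact)
  finally show ?thesis ..
qed

text \<open>
  With \<open>a = k/2\<close> and \<open>b = l/2\<close> the factors \<open>(a)_u\<close> of \<open>\<omega>_k(u)\<close> and \<open>(a+u)_j\<close> of the commutation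
  coefficient merge into \<open>(a)_(u+j)\<close>, which depends only on \<open>m - v\<close>. So for fixed \<open>v\<close> the sum over
  \<open>u\<close> is a Chu-Vandermonde sum, and what is left is the Pfaff-Saalschuetz sum over \<open>v\<close>.
\<close>
lemma omega_convolution:
  "(\<Sum>u\<le>m. \<Sum>v\<le>m - u. omega k u * omega l v * commcoeff (k + 2 * int u) (m - u - v)
      * (pochhammer (of_int l + of_nat v) (m - u - v) / 2 ^ (m - u - v))) = omega (k + l) m"
proof -
  define a b where "a = (of_int k / 2 :: complex)" and "b = (of_int l / 2 :: complex)"
  let ?p = "pochhammer :: complex \<Rightarrow> nat \<Rightarrow> complex"
  let ?c = "2 * b"
  have "(\<Sum>u\<le>m. \<Sum>v\<le>m - u. omega k u * omega l v * commcoeff (k + 2 * int u) (m - u - v)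
      * (pochhammer (of_int l + of_nat v) (m - u - v) / 2 ^ (m - u - v)))
    = (\<Sum>u\<le>m. \<Sum>v\<le>m - u. ?p a (m - v) * ?p b v * ?p (b + 1) v / fact v
      * (?p (a + 1) u / fact u * (?p (?c + of_nat v) (m - v - u) / fact (m - v - u))))"
  proof (intro sum.cong refl, goal_cases)
    case (1 u v)
    define j where "j = m - u - v"
    have j: "m - v = u + j" "m - v - u = j" using 1 by (auto simp: j_def)
    have cc: "commcoeff (k + 2 * int u) j = 2 ^ j * ?p (a + of_nat u) j / fact j"
      by (simp add: commcoeff_def a_def add_divide_distrib)
    have l: "of_int l + of_nat v = ?c + of_nat v"
      by (simp add: b_def)
    show ?case
      unfolding j_def[symmetric] j omega_pochhammer a_def[symmetric] b_def[symmetric]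
        cc l pochhammer_product' by (simp add: ac_simps)
  qed
  also have "\<dots> = (\<Sum>v\<le>m. \<Sum>u\<le>m - v. ?p a (m - v) * ?p b v * ?p (b + 1) v / fact v
      * (?p (a + 1) u / fact u * (?p (?c + of_nat v) (m - v - u) / fact (m - v - u))))"
    unfolding sum.Sigma[OF finite_atMost ballI[OF finite_atMost]]
    by (rule sum.reindex_bij_witness[where i = "\<lambda>(u, v). (v, u)" and j = "\<lambda>(u, v). (v, u)"]) auto
  also have "\<dots> = (\<Sum>v\<le>m. saalschuetz_term a b m v)"
    by (simp only: sum_distrib_left[symmetric] pochhammer_convolution)
      (simp add: saalschuetz_term_def ac_simps)
  also have "\<dots> = omega (k + l) m"
    by (simp add: saalschuetz_sum omega_pochhammer a_def b_def add_divide_distrib)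
  finally show ?thesis .
qed

lemma omega_0_left: "omega 0 u = (if u = 0 then 1 else 0)"
  by (simp add: omega_pochhammer pochhammer_0_left)

section \<open>The skew product attached to a derivation\<close>

text \<open>
  Everything that the ring of skew Laurent series needs from the algebra of functions: a domain
  containing the complex numbers through \<open>s\<close>, with a derivation that kills them.
\<close>
locale scalar_derivation =
  fixes s :: "complex \<Rightarrow> 'a::idom" and \<delta> :: "'a \<Rightarrow> 'a"
  assumes s_add: "s (a + b) = s a + s b"
    and s_mult: "s (a * b) = s a * s b"
    and s_1 [simp]: "s 1 = 1"
    and \<delta>_add: "\<delta> (f + g) = \<delta> f + \<delta> g"
    and \<delta>_mult: "\<delta> (f * g) = f * \<delta> g + \<delta> f * g"
    and \<delta>_s [simp]: "\<delta> (s a) = 0"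
begin

lemma s_0 [simp]: "s 0 = 0"
  by (metis add_0_right add_cancel_right_right s_add)

lemma s_sum: "s (sum h A) = (\<Sum>x\<in>A. s (h x))"
  by (induction A rule: infinite_finite_induct) (auto simp: s_add)

lemma s_of_nat: "s (of_nat n) = of_nat n"
  by (induction n) (auto simp: s_add)

lemma s_power: "s (a ^ n) = s a ^ n"
  by (induction n) (auto simp: s_mult)

lemma s_minus: "s (- a) = - s a"
  using s_add[of a "- a"] by (simp add: eq_neg_iff_add_eq_0 add.commute)

lemma s_diff: "s (a - b) = s a - s b"
  using s_add[of a "- b"] by (simp add: s_minus)

lemma \<delta>_0 [simp]: "\<delta> 0 = 0"
  by (metis add_0_right add_cancel_right_right \<delta>_add)

lemma \<delta>_scale: "\<delta> (s a * f) = s a * \<delta> f"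
  by (simp add: \<delta>_mult)

lemma \<delta>_1 [simp]: "\<delta> 1 = 0"
  using \<delta>_s[of 1] by simp

lemma dpow_0 [simp]: "(\<delta> ^^ k) 0 = 0"
  by (induction k) auto

lemma dpow_1: "(\<delta> ^^ k) 1 = (if k = 0 then 1 else 0)"
  by (cases k) (auto simp: funpow_Suc_right simp del: funpow.simps)

lemma dpow_add: "(\<delta> ^^ k) (f + g) = (\<delta> ^^ k) f + (\<delta> ^^ k) g"
  by (induction k) (auto simp: \<delta>_add)

lemma dpow_sum: "(\<delta> ^^ k) (sum h A) = (\<Sum>x\<in>A. (\<delta> ^^ k) (h x))"
  by (induction A rule: infinite_finite_induct) (auto simp: dpow_add)

lemma dpow_scale: "(\<delta> ^^ k) (s a * f) = s a * (\<delta> ^^ k) f"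
  by (induction k) (auto simp: \<delta>_scale)

lemma dpow_dpow: "(\<delta> ^^ k) ((\<delta> ^^ l) f) = (\<delta> ^^ (k + l)) f"
  by (simp add: funpow_add)

lemma dpow_mult:
  "(\<delta> ^^ n) (f * g) = (\<Sum>k\<le>n. of_nat (n choose k) * ((\<delta> ^^ k) f * (\<delta> ^^ (n - k)) g))"
proof (induction n)
  case (Suc n)
  let ?D = "\<lambda>i j. (\<delta> ^^ i) f * (\<delta> ^^ j) g"
  have *: "\<delta> (of_nat m) = 0" for m :: nat
    using \<delta>_s[of "of_nat m"] by (simp only: s_of_nat)
  have "\<delta> (sum h A) = (\<Sum>x\<in>A. \<delta> (h x))" for h and A :: "nat set"
    using dpow_sum[of 1] by simp
  then have "(\<delta> ^^ Suc n) (f * g) = (\<Sum>k\<le>n. of_nat (n choose k) * ?D k (Suc (n - k)))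
      + (\<Sum>k\<le>n. of_nat (n choose k) * ?D (Suc k) (n - k))"
    by (simp add: Suc * \<delta>_mult ring_distribs sum.distrib)
  also have "(\<Sum>k\<le>n. of_nat (n choose k) * ?D k (Suc (n - k)))
      = (\<Sum>k\<le>Suc n. of_nat (n choose k) * ?D k (Suc n - k))"
    by (simp add: Suc_diff_le binomial_eq_0)
  also have "\<dots> = ?D 0 (Suc n)
      + (\<Sum>k\<le>n. of_nat (n choose Suc k) * ?D (Suc k) (Suc n - Suc k))"
    by (subst sum.atMost_Suc_shift) simp
  also have "\<dots> + (\<Sum>k\<le>n. of_nat (n choose k) * ?D (Suc k) (n - k))
      = ?D 0 (Suc n) + (\<Sum>k\<le>n. of_nat (Suc n choose Suc k) * ?D (Suc k) (Suc n - Suc k))"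
    by (simp add: ring_distribs sum.distrib ac_simps)
  also have "\<dots> = (\<Sum>k\<le>Suc n. of_nat (Suc n choose k) * ?D k (Suc n - k))"
    by (subst sum.atMost_Suc_shift) simp
  finally show ?case .
qed auto

text \<open>
  Associativity for monomials: both sides are the coefficient of \<open>y^(i+j+2N)\<close> in \<open>y^i f y^j g\<close>. On the
  left \<open>y^i\<close> is moved past \<open>f\<close> and then \<open>y^(i+2l+j)\<close> past \<open>g\<close>; on the right \<open>y^j\<close> is moved past \<open>g\<close> and then
  \<open>y^i\<close> past the product.
\<close>
lemma monomial_cocycle:
  "(\<Sum>l\<le>N. s (commcoeff i l) * (s (commcoeff (i + j + 2 * int l) (N - l))
        * ((\<delta> ^^ l) f * (\<delta> ^^ (N - l)) g)))
   = (\<Sum>p\<le>N. s (commcoeff i p) * (\<delta> ^^ p) (f * (s (commcoeff j (N - p)) * (\<delta> ^^ (N - p)) g)))"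
proof -
  let ?D = "\<lambda>l. (\<delta> ^^ l) f * (\<delta> ^^ (N - l)) g"
  let ?c = "\<lambda>l p. commcoeff i p * commcoeff j (N - p) * of_nat (p choose l)"
  have "(\<Sum>p\<le>N. s (commcoeff i p) * (\<delta> ^^ p) (f * (s (commcoeff j (N - p)) * (\<delta> ^^ (N - p)) g)))
      = (\<Sum>p\<le>N. \<Sum>l\<le>p. s (?c l p) * ?D l)"
  proof (intro sum.cong refl)
    fix p assume "p \<in> {..N}"
    then have p: "p \<le> N" by simp
    have "f * (s (commcoeff j (N - p)) * (\<delta> ^^ (N - p)) g)
        = s (commcoeff j (N - p)) * (f * (\<delta> ^^ (N - p)) g)"
      by (simp add: ac_simps)
    then have "s (commcoeff i p) * (\<delta> ^^ p) (f * (s (commcoeff j (N - p)) * (\<delta> ^^ (N - p)) g))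
        = s (commcoeff i p) * (s (commcoeff j (N - p)) * (\<Sum>l\<le>p. of_nat (p choose l)
            * ((\<delta> ^^ l) f * (\<delta> ^^ (p - l)) ((\<delta> ^^ (N - p)) g))))"
      by (simp only: dpow_scale) (simp only: dpow_mult)
    also have "\<dots> = (\<Sum>l\<le>p. s (?c l p) * ?D l)"
      using p by (simp add: dpow_dpow sum_distrib_left s_mult s_of_nat ac_simps)
    finally show "s (commcoeff i p)
        * (\<delta> ^^ p) (f * (s (commcoeff j (N - p)) * (\<delta> ^^ (N - p)) g))
        = (\<Sum>l\<le>p. s (?c l p) * ?D l)" .
  qed
  also have "\<dots> = (\<Sum>l\<le>N. \<Sum>p\<in>{l..N}. s (?c l p) * ?D l)"
    unfolding sum.Sigma[OF finite_atMost ballI[OF finite_atMost]]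
      sum.Sigma[OF finite_atMost ballI[OF finite_atLeastAtMost]]
    by (rule sum.reindex_bij_witness[where i = "\<lambda>(l, p). (p, l)" and j = "\<lambda>(p, l). (l, p)"]) auto
  also have "\<dots> = (\<Sum>l\<le>N. s (commcoeff i l) * (s (commcoeff (i + j + 2 * int l) (N - l)) * ?D l))"
  proof (intro sum.cong refl)
    fix l assume "l \<in> {..N}"
    then have l: "l \<le> N" by simp
    have "(\<Sum>p\<in>{l..N}. ?c l p) = (\<Sum>t\<le>N - l. ?c l (l + t))"
      using l by (intro sum.reindex_bij_witness[where i = "\<lambda>t. l + t" and j = "\<lambda>p. p - l"]) auto
    also have "\<dots> = (\<Sum>t\<le>N - l. commcoeff i l
        * (commcoeff (i + 2 * int l) t * commcoeff j (N - l - t)))"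
      by (intro sum.cong refl)
        (simp only: mult.assoc[symmetric] commcoeff_shift diff_diff_left, simp only: ac_simps)
    also have "\<dots> = commcoeff i l * commcoeff (i + 2 * int l + j) (N - l)"
      by (simp add: commcoeff_add sum_distrib_left)
    finally have "(\<Sum>p\<in>{l..N}. ?c l p) = commcoeff i l * commcoeff (i + j + 2 * int l) (N - l)"
      by (simp add: ac_simps)
    moreover have "(\<Sum>p\<in>{l..N}. s (?c l p) * ?D l) = s (\<Sum>p\<in>{l..N}. ?c l p) * ?D l"
      by (simp only: s_sum sum_distrib_right)
    ultimately show "(\<Sum>p\<in>{l..N}. s (?c l p) * ?D l)
        = s (commcoeff i l) * (s (commcoeff (i + j + 2 * int l) (N - l)) * ?D l)"
      by (simp only: s_mult mult.assoc)
  qed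
  finally show ?thesis by simp
qed

text \<open>
  The product \<open>(\<Sum>i. f_i y^i) (\<Sum>j. g_j y^j)\<close> computed with the closed form of \<open>y^i g_j\<close>. The bounds
  contain all the indices for which the summand can be nonzero.
\<close>
definition sprod :: "'a fls \<Rightarrow> 'a fls \<Rightarrow> 'a fls" where
  "sprod f g = Abs_fls (\<lambda>n. \<Sum>i = fls_subdegree f..n - fls_subdegree g.
     fls_nth f i * (\<Sum>k\<le>nat (n - i - fls_subdegree g).
       s (commcoeff i k) * (\<delta> ^^ k) (fls_nth g (n - i - 2 * int k))))"

text \<open>
  The summation ranges may be any finite sets that contain the relevant indices. With fixed
  rectangular ranges and the constraint \<open>i + j + 2 k = n\<close> inside the summand, sums can be interchanged
  freely, which reduces associativity and bilinearity to computations with coefficients.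
\<close>
lemma sprod_nth:
  assumes f: "\<And>i. i < p \<Longrightarrow> fls_nth f i = 0" and g: "\<And>j. j < q \<Longrightarrow> fls_nth g j = 0"
    and IJK: "finite I" "finite J" "finite K"
    and box: "{p..n - q} \<subseteq> I" "{q..n - p} \<subseteq> J" "{..nat (n - p - q)} \<subseteq> K"
  shows "fls_nth (sprod f g) n = (\<Sum>i\<in>I. \<Sum>j\<in>J. \<Sum>k\<in>K. if i + j + 2 * int k = n
    then fls_nth f i * (s (commcoeff i k) * (\<delta> ^^ k) (fls_nth g j)) else 0)"
proof -
  let ?F = "\<lambda>i k. fls_nth f i * (s (commcoeff i k) * (\<delta> ^^ k) (fls_nth g (n - i - 2 * int k)))"
  define S where "S = {(i, k). ?F i k \<noteq> 0}"
  have S: "fls_nth f i \<noteq> 0" "fls_nth g (n - i - 2 * int k) \<noteq> 0" if "(i, k) \<in> S" for i k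
    using that by (auto simp: S_def)
  have bounds: "p \<le> i" "q \<le> n - i - 2 * int k" if "(i, k) \<in> S" for i k
    using S[OF that] f g by (meson not_le)+
  have eq: "(\<Sum>i\<in>A. \<Sum>k\<in>B. ?F i k) = (\<Sum>(i, k)\<in>S. ?F i k)"
    if "finite A" "finite B" "S \<subseteq> A \<times> B" for A B
    unfolding sum.cartesian_product using that
    by (intro sum.mono_neutral_right) (auto simp: S_def)
  have "fls_nth (sprod f g) n = (\<Sum>i = fls_subdegree f..n - fls_subdegree g.
      fls_nth f i * (\<Sum>k\<le>nat (n - i - fls_subdegree g).
       s (commcoeff i k) * (\<delta> ^^ k) (fls_nth g (n - i - 2 * int k))))"
    unfolding sprod_def
    by (rule nth_Abs_fls_lower_bound[of "fls_subdegree f + fls_subdegree g"]) auto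
  also have "\<dots> = (\<Sum>i = fls_subdegree f..n - fls_subdegree g.
      \<Sum>k\<le>nat (n - fls_subdegree f - fls_subdegree g). ?F i k)"
    unfolding sum_distrib_left by (intro sum.cong refl sum.mono_neutral_left) auto
  also have "\<dots> = (\<Sum>(i, k)\<in>S. ?F i k)"
  proof (rule eq)
    show "S \<subseteq> {fls_subdegree f..n - fls_subdegree g}
        \<times> {..nat (n - fls_subdegree f - fls_subdegree g)}"
    proof clarify
      fix i k assume "(i, k) \<in> S"
      from S[OF this] have "fls_subdegree f \<le> i" "fls_subdegree g \<le> n - i - 2 * int k"
        by (auto intro: fls_subdegree_leI)
      then show "i \<in> {fls_subdegree f..n - fls_subdegree g}
          \<and> k \<in> {..nat (n - fls_subdegree f - fls_subdegree g)}" by auto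
    qed
  qed auto
  also have "\<dots> = (\<Sum>i\<in>I. \<Sum>k\<in>K. ?F i k)"
  proof (rule eq[symmetric])
    have "i \<in> {p..n - q} \<and> k \<in> {..nat (n - p - q)}" if "(i, k) \<in> S" for i k
      using bounds[OF that] by auto
    then show "S \<subseteq> I \<times> K" using box by fast
  qed (use IJK in auto)
  also have "\<dots> = (\<Sum>i\<in>I. \<Sum>k\<in>K. \<Sum>j\<in>J. if i + j + 2 * int k = n
      then fls_nth f i * (s (commcoeff i k) * (\<delta> ^^ k) (fls_nth g j)) else 0)"
  proof (intro sum.cong refl)
    fix i k
    have "(\<Sum>j\<in>J. if i + j + 2 * int k = n
        then fls_nth f i * (s (commcoeff i k) * (\<delta> ^^ k) (fls_nth g j)) else 0)
      = (\<Sum>j\<in>J. if j = n - i - 2 * int k then ?F i k else 0)"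
      by (intro sum.cong) auto
    also have "\<dots> = (if n - i - 2 * int k \<in> J then ?F i k else 0)"
      using IJK by (simp add: sum.delta)
    also have "\<dots> = ?F i k"
    proof (cases "?F i k = 0")
      case False
      then have "(i, k) \<in> S" by (simp add: S_def)
      then have "n - i - 2 * int k \<in> {q..n - p}"
        using bounds[of i k] by auto
      then have "n - i - 2 * int k \<in> J" using box(2) by blast
      then show ?thesis by simp
    qed auto
    finally show "?F i k = (\<Sum>j\<in>J. if i + j + 2 * int k = n
        then fls_nth f i * (s (commcoeff i k) * (\<delta> ^^ k) (fls_nth g j)) else 0)" ..
  qed
  also have "\<dots> = (\<Sum>i\<in>I. \<Sum>j\<in>J. \<Sum>k\<in>K. if i + j + 2 * int k = n
      then fls_nth f i * (s (commcoeff i k) * (\<delta> ^^ k) (fls_nth g j)) else 0)"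
    by (intro sum.cong refl sum.swap)
  finally show ?thesis .
qed

lemma sprod_nth_below:
  assumes f: "\<And>i. i < p \<Longrightarrow> fls_nth f i = 0" and g: "\<And>j. j < q \<Longrightarrow> fls_nth g j = 0"
    and n: "n < p + q"
  shows "fls_nth (sprod f g) n = 0"
  using sprod_nth[OF f g, where I = "{}" and J = "{}" and K = "{..0}" and n = n] n by simp

lemma sprod_nth_lowest:
  assumes f: "\<And>i. i < p \<Longrightarrow> fls_nth f i = 0" and g: "\<And>j. j < q \<Longrightarrow> fls_nth g j = 0"
  shows "fls_nth (sprod f g) (p + q) = fls_nth f p * fls_nth g q"
  using sprod_nth[OF f g, where I = "{p}" and J = "{q}" and K = "{0}" and n = "p + q"] by simp

lemma sprod_add_left: "sprod (f + f') g = sprod f g + sprod f' g"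
proof (rule fls_eqI)
  fix n
  define p where "p = min (fls_subdegree f) (fls_subdegree f')"
  define q where "q = fls_subdegree g"
  note sprod = sprod_nth[where p = p and q = q and I = "{p..n - q}" and J = "{q..n - p}"
      and K = "{..nat (n - p - q)}" and n = n]
  show "fls_nth (sprod (f + f') g) n = fls_nth (sprod f g + sprod f' g) n"
    unfolding fls_plus_nth
    by (subst (1 2 3) sprod)
      (auto simp: p_def q_def sum.distrib[symmetric] ring_distribs intro!: sum.cong)
qed

lemma sprod_add_right: "sprod f (g + g') = sprod f g + sprod f g'"
proof (rule fls_eqI)
  fix n
  define p where "p = fls_subdegree f"
  define q where "q = min (fls_subdegree g) (fls_subdegree g')"
  note sprod = sprod_nth[where p = p and q = q and I = "{p..n - q}" and J = "{q..n - p}"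
      and K = "{..nat (n - p - q)}" and n = n]
  show "fls_nth (sprod f (g + g')) n = fls_nth (sprod f g + sprod f g') n"
    unfolding fls_plus_nth
    by (subst (1 2 3) sprod)
      (auto simp: p_def q_def sum.distrib[symmetric] ring_distribs dpow_add intro!: sum.cong)
qed

lemma sum_antidiagonal:
  fixes G :: "nat \<Rightarrow> nat \<Rightarrow> 'b::comm_monoid_add"
  assumes "n - S \<le> int M"
  shows "(\<Sum>l\<le>M. \<Sum>k\<le>M. if S + 2 * int l + 2 * int k = n then G l k else 0)
    = (if S \<le> n \<and> even (n - S) then \<Sum>l\<le>nat ((n - S) div 2). G l (nat ((n - S) div 2) - l) else 0)"
proof (cases "S \<le> n \<and> even (n - S)")
  case True
  define N where "N = nat ((n - S) div 2)"
  have n: "n = S + 2 * int N" using True by (auto simp: N_def)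
  with assms have "N \<le> M" by simp
  have "(\<Sum>l\<le>M. \<Sum>k\<le>M. if S + 2 * int l + 2 * int k = n then G l k else 0)
      = (\<Sum>l\<le>M. if l \<le> N then G l (N - l) else 0)"
  proof (intro sum.cong refl)
    fix l
    have "(\<Sum>k\<le>M. if S + 2 * int l + 2 * int k = n then G l k else 0)
        = (\<Sum>k\<le>M. if k = N - l then if l \<le> N then G l k else 0 else 0)"
      unfolding n by (intro sum.cong) auto
    then show "(\<Sum>k\<le>M. if S + 2 * int l + 2 * int k = n then G l k else 0)
        = (if l \<le> N then G l (N - l) else 0)"
      using \<open>N \<le> M\<close> by (auto simp: sum.delta)
  qed
  also have "\<dots> = (\<Sum>l\<le>N. G l (N - l))"
    using \<open>N \<le> M\<close> by (intro sum.mono_neutral_cong_right) auto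
  finally show ?thesis using True by (simp add: N_def)
next
  case False
  have "S + 2 * int l + 2 * int k \<noteq> n" for l k
  proof
    assume "S + 2 * int l + 2 * int k = n"
    then have "n - S = 2 * (int l + int k)" by simp
    with False show False by simp
  qed
  with False show ?thesis by auto
qed

text \<open>
  Once the six-fold sums for both bracketings are reduced to sums over the exponents \<open>i\<close>, \<open>j\<close>, \<open>t\<close> of
  the three factors and two orders of differentiation, \<open>monomial_cocycle\<close> matches them exponent by
  exponent.
\<close>
lemma sprod_assoc: "sprod (sprod f g) h = sprod f (sprod g h)"
proof (rule fls_eqI)
  fix n
  define p q r where "p = fls_subdegree f" and "q = fls_subdegree g" and "r = fls_subdegree h"
  define M where "M = nat (n - p - q - r)"
  \<comment> \<open>The ranges for the exponents of f, g, h are those that can contribute to y^n when each of the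
    other two factors has at least its lowest exponent; they serve both bracketings.\<close>
  let ?I = "{p..n - q - r}" and ?J = "{q..n - p - r}" and ?H = "{r..n - p - q}"
  have vanish: "\<And>i. i < p \<Longrightarrow> fls_nth f i = 0" "\<And>i. i < q \<Longrightarrow> fls_nth g i = 0"
    "\<And>i. i < r \<Longrightarrow> fls_nth h i = 0"
    by (simp_all add: p_def q_def r_def)
  have vanish_fg: "fls_nth (sprod f g) i = 0" if "i < p + q" for i
    using that by (intro sprod_nth_below vanish)
  have vanish_gh: "fls_nth (sprod g h) i = 0" if "i < q + r" for i
    using that by (intro sprod_nth_below vanish)
  have nth_fg: "fls_nth (sprod f g) m = (\<Sum>i\<in>?I. \<Sum>j\<in>?J. \<Sum>l\<le>M. if i + j + 2 * int l = m
      then fls_nth f i * (s (commcoeff i l) * (\<delta> ^^ l) (fls_nth g j)) else 0)"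
    if "m \<in> {p + q..n - r}" for m
    using that by (intro sprod_nth[where p = p and q = q] vanish) (auto simp: M_def)
  have nth_gh: "fls_nth (sprod g h) m = (\<Sum>j\<in>?J. \<Sum>t\<in>?H. \<Sum>l\<le>M. if j + t + 2 * int l = m
      then fls_nth g j * (s (commcoeff j l) * (\<delta> ^^ l) (fls_nth h t)) else 0)"
    if "m \<in> {q + r..n - p}" for m
    using that by (intro sprod_nth[where p = q and q = r] vanish) (auto simp: M_def)
  let ?L = "\<lambda>m i j t l k. fls_nth f i * (s (commcoeff i l) * (\<delta> ^^ l) (fls_nth g j))
      * (s (commcoeff m k) * (\<delta> ^^ k) (fls_nth h t))"
  let ?R = "\<lambda>i j t l k. fls_nth f i * (s (commcoeff i l)
      * (\<delta> ^^ l) (fls_nth g j * (s (commcoeff j k) * (\<delta> ^^ k) (fls_nth h t))))"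
  have "fls_nth (sprod (sprod f g) h) n = (\<Sum>m = p + q..n - r. \<Sum>t\<in>?H. \<Sum>k\<le>M.
      if m + t + 2 * int k = n
      then fls_nth (sprod f g) m * (s (commcoeff m k) * (\<delta> ^^ k) (fls_nth h t)) else 0)"
    by (intro sprod_nth[where p = "p + q" and q = r] vanish vanish_fg) (auto simp: M_def)
  also have "\<dots> = (\<Sum>m = p + q..n - r. \<Sum>t\<in>?H. \<Sum>k\<le>M. \<Sum>i\<in>?I. \<Sum>j\<in>?J. \<Sum>l\<le>M.
      if m + t + 2 * int k = n \<and> i + j + 2 * int l = m then ?L m i j t l k else 0)"
  proof (intro sum.cong refl, goal_cases)
    case (1 m t k)
    show ?case
    proof (cases "m + t + 2 * int k = n")
      case True
      show ?thesis unfolding nth_fg[OF 1(1)]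
        using True by (simp only: if_True simp_thms sum_distrib_right mult_zero_left if_distrib[of "\<lambda>x. x * _"] cong: if_cong)
    qed simp
  qed
  \<comment> \<open>The intermediate exponent m is summed last, where the constraint determines it.\<close>
  also have "\<dots> = (\<Sum>i\<in>?I. \<Sum>j\<in>?J. \<Sum>t\<in>?H. \<Sum>l\<le>M. \<Sum>k\<le>M. \<Sum>m = p + q..n - r.
      if m + t + 2 * int k = n \<and> i + j + 2 * int l = m then ?L m i j t l k else 0)"
    unfolding sum.cartesian_product
    by (rule sum.reindex_bij_witness[where i = "\<lambda>(i, j, t, l, k, m). (m, t, k, i, j, l)"
          and j = "\<lambda>(m, t, k, i, j, l). (i, j, t, l, k, m)"]) auto
  also have "\<dots> = (\<Sum>i\<in>?I. \<Sum>j\<in>?J. \<Sum>t\<in>?H. \<Sum>l\<le>M. \<Sum>k\<le>M.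
      if i + j + t + 2 * int l + 2 * int k = n then ?L (i + j + 2 * int l) i j t l k else 0)"
  proof (intro sum.cong refl, goal_cases)
    case (1 i j t l k)
    have "(\<Sum>m = p + q..n - r. if m + t + 2 * int k = n \<and> i + j + 2 * int l = m
          then ?L m i j t l k else 0)
        = (\<Sum>m = p + q..n - r. if m = i + j + 2 * int l
          then if i + j + t + 2 * int l + 2 * int k = n then ?L m i j t l k else 0 else 0)"
      by (intro sum.cong refl) auto
    also have "\<dots> = (if i + j + t + 2 * int l + 2 * int k = n
        then ?L (i + j + 2 * int l) i j t l k else 0)"
      using 1 by (auto simp: sum.delta)
    finally show ?case .
  qed
  finally have left: "fls_nth (sprod (sprod f g) h) n
    = (\<Sum>i\<in>?I. \<Sum>j\<in>?J. \<Sum>t\<in>?H. \<Sum>l\<le>M. \<Sum>k\<le>M.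
      if i + j + t + 2 * int l + 2 * int k = n then ?L (i + j + 2 * int l) i j t l k else 0)" .
  have "fls_nth (sprod f (sprod g h)) n = (\<Sum>i\<in>?I. \<Sum>m = q + r..n - p. \<Sum>l\<le>M.
      if i + m + 2 * int l = n
      then fls_nth f i * (s (commcoeff i l) * (\<delta> ^^ l) (fls_nth (sprod g h) m)) else 0)"
    by (intro sprod_nth[where p = p and q = "q + r"] vanish vanish_gh) (auto simp: M_def)
  also have "\<dots> = (\<Sum>i\<in>?I. \<Sum>m = q + r..n - p. \<Sum>l\<le>M. \<Sum>j\<in>?J. \<Sum>t\<in>?H. \<Sum>k\<le>M.
      if i + m + 2 * int l = n \<and> j + t + 2 * int k = m then ?R i j t l k else 0)"
  proof (intro sum.cong refl, goal_cases)
    case (1 i m l)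
    show ?case
    proof (cases "i + m + 2 * int l = n")
      case True
      show ?thesis unfolding nth_gh[OF 1(2)]
        using True by (simp only: if_True simp_thms dpow_sum sum_distrib_left mult_zero_right dpow_0
            if_distrib[of "\<lambda>x. _ * x"] if_distrib[of "\<delta> ^^ _"] cong: if_cong)
    qed simp
  qed
  also have "\<dots> = (\<Sum>i\<in>?I. \<Sum>j\<in>?J. \<Sum>t\<in>?H. \<Sum>l\<le>M. \<Sum>k\<le>M. \<Sum>m = q + r..n - p.
      if i + m + 2 * int l = n \<and> j + t + 2 * int k = m then ?R i j t l k else 0)"
    unfolding sum.cartesian_product
    by (rule sum.reindex_bij_witness[where i = "\<lambda>(i, j, t, l, k, m). (i, m, l, j, t, k)"
          and j = "\<lambda>(i, m, l, j, t, k). (i, j, t, l, k, m)"]) auto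
  also have "\<dots> = (\<Sum>i\<in>?I. \<Sum>j\<in>?J. \<Sum>t\<in>?H. \<Sum>l\<le>M. \<Sum>k\<le>M.
      if i + j + t + 2 * int l + 2 * int k = n then ?R i j t l k else 0)"
  proof (intro sum.cong refl, goal_cases)
    case (1 i j t l k)
    have "(\<Sum>m = q + r..n - p. if i + m + 2 * int l = n \<and> j + t + 2 * int k = m
          then ?R i j t l k else 0)
        = (\<Sum>m = q + r..n - p. if m = j + t + 2 * int k
          then if i + j + t + 2 * int l + 2 * int k = n then ?R i j t l k else 0 else 0)"
      by (intro sum.cong refl) auto
    also have "\<dots> = (if i + j + t + 2 * int l + 2 * int k = n then ?R i j t l k else 0)"
      using 1 by (auto simp: sum.delta)
    finally show ?case .
  qed
  finally have right: "fls_nth (sprod f (sprod g h)) n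
    = (\<Sum>i\<in>?I. \<Sum>j\<in>?J. \<Sum>t\<in>?H. \<Sum>l\<le>M. \<Sum>k\<le>M.
      if i + j + t + 2 * int l + 2 * int k = n then ?R i j t l k else 0)" .
  show "fls_nth (sprod (sprod f g) h) n = fls_nth (sprod f (sprod g h)) n"
    unfolding left right
  proof (rule sum.cong[OF refl], rule sum.cong[OF refl], rule sum.cong[OF refl], goal_cases)
    case (1 i j t)
    then have bound: "n - (i + j + t) \<le> int M" by (auto simp: M_def)
    define N where "N = nat ((n - (i + j + t)) div 2)"
    have "(\<Sum>l\<le>N. ?L (i + j + 2 * int l) i j t l (N - l)) = (\<Sum>l\<le>N. ?R i j t l (N - l))"
      using arg_cong[OF monomial_cocycle[where i = i and j = j and f = "fls_nth g j"
            and g = "fls_nth h t" and N = N], of "\<lambda>x. fls_nth f i * x"]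
      by (simp only: sum_distrib_left ac_simps)
    then show ?case
      unfolding sum_antidiagonal[OF bound] N_def by (simp only:)
  qed
qed

lemma fls_monomial_nth: "fls_nth (fls_shift (- i) (fls_const a)) n = (if n = i then a else 0)"
  by simp

lemma sprod_monomial_left_nth:
  "fls_nth (sprod (fls_shift (- i) (fls_const a)) g) n = a * (\<Sum>k\<le>nat (n - i - fls_subdegree g).
     s (commcoeff i k) * (\<delta> ^^ k) (fls_nth g (n - i - 2 * int k)))"
proof -
  let ?S = "\<lambda>i. \<Sum>k\<le>nat (n - i - fls_subdegree g).
     s (commcoeff i k) * (\<delta> ^^ k) (fls_nth g (n - i - 2 * int k))"
  have "fls_nth (sprod (fls_shift (- i) (fls_const a)) g) n
      = (\<Sum>i' = i..n - fls_subdegree g. \<Sum>j = fls_subdegree g..n - i.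
          \<Sum>k\<le>nat (n - i - fls_subdegree g). if i' + j + 2 * int k = n
          then fls_nth (fls_shift (- i) (fls_const a)) i'
            * (s (commcoeff i' k) * (\<delta> ^^ k) (fls_nth g j)) else 0)"
    by (intro sprod_nth) auto
  also have "\<dots> = (\<Sum>i' = i..n - fls_subdegree g. if i' = i then
      \<Sum>j = fls_subdegree g..n - i. \<Sum>k\<le>nat (n - i - fls_subdegree g). if i + j + 2 * int k = n
          then a * (s (commcoeff i k) * (\<delta> ^^ k) (fls_nth g j)) else 0 else 0)"
    unfolding fls_monomial_nth by (intro sum.cong refl) (auto cong: if_cong)
  also have "\<dots> = (\<Sum>j = fls_subdegree g..n - i. \<Sum>k\<le>nat (n - i - fls_subdegree g).
      if i + j + 2 * int k = n then a * (s (commcoeff i k) * (\<delta> ^^ k) (fls_nth g j)) else 0)"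
    by (auto simp: sum.delta)
  also have "\<dots> = (\<Sum>k\<le>nat (n - i - fls_subdegree g). \<Sum>j = fls_subdegree g..n - i.
      if j = n - i - 2 * int k then a * (s (commcoeff i k) * (\<delta> ^^ k) (fls_nth g j)) else 0)"
    by (subst sum.swap) (intro sum.cong refl, auto)
  also have "\<dots> = (\<Sum>k\<le>nat (n - i - fls_subdegree g).
      a * (s (commcoeff i k) * (\<delta> ^^ k) (fls_nth g (n - i - 2 * int k))))"
    by (intro sum.cong refl) (auto simp: sum.delta)
  finally show ?thesis by (simp add: sum_distrib_left)
qed

lemma sprod_const_left_nth: "fls_nth (sprod (fls_const a) g) n = a * fls_nth g n"
proof -
  have "(\<Sum>k\<le>nat (n - fls_subdegree g).
      s (commcoeff 0 k) * (\<delta> ^^ k) (fls_nth g (n - 2 * int k)))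
    = (\<Sum>k\<le>nat (n - fls_subdegree g). if k = 0 then fls_nth g n else 0)"
    by (intro sum.cong refl) (auto simp: commcoeff_0_left)
  then show ?thesis
    using sprod_monomial_left_nth[of 0 a g n] by (simp add: sum.delta)
qed

lemma sprod_1_left [simp]: "sprod 1 g = g"
  using sprod_const_left_nth[of 1 g] by (intro fls_eqI) (simp add: fls_const_1)

lemma sprod_1_right [simp]: "sprod f 1 = f"
proof (rule fls_eqI)
  fix n
  have "fls_nth (sprod f 1) n = (\<Sum>i = fls_subdegree f..n. \<Sum>j = 0..n - fls_subdegree f.
      \<Sum>k\<le>nat (n - fls_subdegree f). if i + j + 2 * int k = n then fls_nth f i
        * (s (commcoeff i k) * (\<delta> ^^ k) (fls_nth 1 j)) else 0)"
    by (intro sprod_nth[where q = 0]) auto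
  also have "\<dots> = (\<Sum>i = fls_subdegree f..n. \<Sum>j = 0..n - fls_subdegree f.
      \<Sum>k\<le>nat (n - fls_subdegree f). if k = 0 then if j = 0 then if i = n then fls_nth f n
        else 0 else 0 else 0)"
    by (intro sum.cong refl) (auto simp: dpow_1)
  also have "\<dots> = fls_nth f n"
    by (auto simp: sum.delta)
  finally show "fls_nth (sprod f 1) n = fls_nth f n" .
qed

lemma sprod_X_intpow: "sprod (fls_X_intpow i) (fls_X_intpow j) = fls_X_intpow (i + j)"
proof (rule fls_eqI)
  fix n
  have "(\<Sum>k\<le>nat (n - i - j). s (commcoeff i k)
      * (\<delta> ^^ k) (fls_nth (fls_X_intpow j) (n - i - 2 * int k)))
    = (\<Sum>k\<le>nat (n - i - j). if k = 0 then if n = i + j then 1 else 0 else 0)"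
    by (intro sum.cong refl) (auto simp: dpow_1)
  then show "fls_nth (sprod (fls_X_intpow i) (fls_X_intpow j)) n
    = fls_nth (fls_X_intpow (i + j)) n"
    using sprod_monomial_left_nth[of i 1 "fls_X_intpow j" n]
    by (simp add: sum.delta fls_const_1 del: fls_shift_nth) simp
qed

lemma sprod_const_X_intpow: "sprod (fls_const a) (fls_X_intpow j) = fls_shift (- j) (fls_const a)"
  by (rule fls_eqI) (simp add: sprod_const_left_nth)

text \<open>
  Since \<open>c(1,k) = (2k)! / (2^k (k!)^2)\<close>, the series on the left is the defining formula for left
  multiplication by \<open>y\<close>.
\<close>
lemma lmult_X:
  "Abs_fls (\<lambda>n. \<Sum>k\<le>nat (n - 1 - fls_subdegree g). s (fact (2 * k) / (2 ^ k * (fact k)\<^sup>2))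
     * (\<delta> ^^ k) (fls_nth g (n - 1 - 2 * int k))) = sprod fls_X g"
proof -
  have "sprod fls_X g = Abs_fls (fls_nth (sprod (fls_X_intpow 1) g))"
    by (simp add: fls_nth_inverse fls_X_conv_shift_1)
  also have "fls_nth (sprod (fls_X_intpow 1) g) = (\<lambda>n. \<Sum>k\<le>nat (n - 1 - fls_subdegree g).
      s (fact (2 * k) / (2 ^ k * (fact k)\<^sup>2)) * (\<delta> ^^ k) (fls_nth g (n - 1 - 2 * int k)))"
    using sprod_monomial_left_nth[of 1 1 g] by (simp add: fls_const_1 commcoeff_1 fun_eq_iff)
  finally show ?thesis ..
qed

lemma sprod_X_intpow_funpow: "(sprod (fls_X_intpow i) ^^ n) g = sprod (fls_X_intpow (int n * i)) g"
  by (induction n) (auto simp: sprod_assoc[symmetric] sprod_X_intpow algebra_simps)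

text \<open>
  Left multiplication by \<open>y\<close> is bijective because \<open>y^(-1)\<close> is a two-sided inverse of \<open>y\<close> for an
  associative product.
\<close>
lemma inv_sprod_X: "inv_into UNIV (sprod fls_X) = sprod (fls_X_intpow (- 1))"
  by (rule inv_unique_comp)
    (auto simp: fun_eq_iff fls_X_conv_shift_1 sprod_assoc[symmetric]
      sprod_X_intpow[of 1 "- 1", simplified] sprod_X_intpow[of "- 1" 1, simplified])

lemma sprod_X_funpow_int:
  "(if i \<ge> 0 then sprod fls_X ^^ nat i else inv_into UNIV (sprod fls_X) ^^ nat (- i)) g
    = sprod (fls_X_intpow i) g"
proof (cases "0 \<le> i")
  case True
  then show ?thesis
    using sprod_X_intpow_funpow[where i = 1 and n = "nat i" and g = g]
    by (simp add: fls_X_conv_shift_1)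
next
  case False
  then show ?thesis
    using sprod_X_intpow_funpow[where i = "- 1" and n = "nat (- i)" and g = g]
    by (simp add: inv_sprod_X)
qed

lemma sprod_altdef:
  "sprod f g = Abs_fls (\<lambda>n. \<Sum>i = fls_subdegree f..n - fls_subdegree g.
     fls_nth f i * fls_nth (sprod (fls_X_intpow i) g) n)"
  using sprod_monomial_left_nth[of _ 1 g] by (simp add: sprod_def fls_const_1)

section \<open>Series with steps of two\<close>

text \<open>
  The series \<open>\<Sum>u. \<alpha>_u y^(k+2u)\<close>. Commuting \<open>y\<close> past a coefficient raises exponents by even
  numbers only, so such series are closed under products.
\<close>
definition even_step :: "int \<Rightarrow> (nat \<Rightarrow> 'a) \<Rightarrow> 'a fls" where
  "even_step k \<alpha> = Abs_fls (\<lambda>n. if k \<le> n \<and> even (n - k) then \<alpha> (nat ((n - k) div 2)) else 0)"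

lemma even_step_nth:
  "fls_nth (even_step k \<alpha>) n = (if k \<le> n \<and> even (n - k) then \<alpha> (nat ((n - k) div 2)) else 0)"
  unfolding even_step_def by (rule nth_Abs_fls_lower_bound[of k]) auto

lemma even_step_nth_below: "n < k \<Longrightarrow> fls_nth (even_step k \<alpha>) n = 0"
  by (simp add: even_step_nth)

lemma even_step_nth_add [simp]: "fls_nth (even_step k \<alpha>) (k + 2 * int u) = \<alpha> u"
  by (simp add: even_step_nth)

lemma even_step_eqI:
  assumes "\<And>u. \<alpha> u = \<beta> u"
  shows "even_step k \<alpha> = even_step k \<beta>"
  by (simp only: even_step_def assms)

lemma even_step_conv_shift: "even_step k (\<lambda>u. if u = 0 then a else 0) = fls_shift (- k) (fls_const a)"
proof (rule fls_eqI)
  fix n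
  have "nat ((n - k) div 2) = 0 \<longleftrightarrow> n = k" if "k \<le> n" "even (n - k)"
  proof -
    from that(2) obtain m where "n - k = 2 * m" ..
    then have "n = k + 2 * m" by simp
    then show ?thesis using that(1) by simp
  qed
  then show "fls_nth (even_step k (\<lambda>u. if u = 0 then a else 0)) n
    = fls_nth (fls_shift (- k) (fls_const a)) n"
    by (simp only: even_step_nth fls_monomial_nth) auto
qed

lemma even_step_sum: 
  fixes F :: "int \<Rightarrow> 'a"
  assumes "n - k \<le> 2 * int M" "\<And>i. \<not> (k \<le> i \<and> even (i - k)) \<Longrightarrow> F i = 0"
  shows "(\<Sum>i = k..n. F i) = (\<Sum>u\<le>M. if k + 2 * int u \<le> n then F (k + 2 * int u) else 0)"
proof -
  have "(\<Sum>i = k..n. F i) = (\<Sum>i \<in> {i. k \<le> i \<and> i \<le> n \<and> even (i - k)}. F i)"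
    using assms(2) by (intro sum.mono_neutral_right) auto
  also have "\<dots> = (\<Sum>u \<in> {u. u \<le> M \<and> k + 2 * int u \<le> n}. F (k + 2 * int u))"
    using assms(1)
    by (intro sum.reindex_bij_witness[where i = "\<lambda>u. k + 2 * int u" and j = "\<lambda>i. nat ((i - k) div 2)"])
      auto
  also have "\<dots> = (\<Sum>u\<le>M. if k + 2 * int u \<le> n then F (k + 2 * int u) else 0)"
    by (intro sum.mono_neutral_cong_left) auto
  finally show ?thesis .
qed

lemma even_step_mult:
  "sprod (even_step k \<alpha>) (even_step l \<beta>) = even_step (k + l) (\<lambda>m. \<Sum>u\<le>m. \<Sum>v\<le>m - u.
     \<alpha> u * (s (commcoeff (k + 2 * int u) (m - u - v)) * (\<delta> ^^ (m - u - v)) (\<beta> v)))"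
proof (rule fls_eqI)
  fix n
  let ?F = "\<lambda>u v N. \<alpha> u * (s (commcoeff (k + 2 * int u) N) * (\<delta> ^^ N) (\<beta> v))"
  define M where "M = nat (n - k - l)"
  have "fls_nth (sprod (even_step k \<alpha>) (even_step l \<beta>)) n
    = (\<Sum>i = k..n - l. \<Sum>j = l..n - k. \<Sum>N\<le>M. if i + j + 2 * int N = n then
        fls_nth (even_step k \<alpha>) i * (s (commcoeff i N) * (\<delta> ^^ N) (fls_nth (even_step l \<beta>) j)) else 0)"
    by (intro sprod_nth even_step_nth_below) (auto simp: M_def)
  also have "\<dots> = (\<Sum>u\<le>M. if k + 2 * int u \<le> n - l then \<Sum>j = l..n - k. \<Sum>N\<le>M.
      if k + 2 * int u + j + 2 * int N = n then
        \<alpha> u * (s (commcoeff (k + 2 * int u) N) * (\<delta> ^^ N) (fls_nth (even_step l \<beta>) j)) else 0 else 0)"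
    by (subst even_step_sum[where k = k and n = "n - l" and M = M])
      (auto simp: M_def even_step_nth cong: if_cong)
  also have "\<dots> = (\<Sum>u\<le>M. if k + 2 * int u \<le> n - l then \<Sum>v\<le>M. if l + 2 * int v \<le> n - k then
      \<Sum>N\<le>M. if k + 2 * int u + (l + 2 * int v) + 2 * int N = n then ?F u v N else 0 else 0 else 0)"
    by (subst even_step_sum[where k = l and n = "n - k" and M = M])
      (auto simp: M_def even_step_nth cong: if_cong)
  also have "\<dots> = (\<Sum>u\<le>M. \<Sum>v\<le>M. \<Sum>N\<le>M.
      if (k + l + 2 * int u) + 2 * int v + 2 * int N = n then ?F u v N else 0)"
    by (intro sum.cong refl) (auto intro!: sum.cong sum.neutral sum.neutral[symmetric])
  also have "\<dots> = (\<Sum>u\<le>M. if k + l + 2 * int u \<le> n \<and> even (n - (k + l + 2 * int u))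
      then \<Sum>v\<le>nat ((n - (k + l + 2 * int u)) div 2). ?F u v (nat ((n - (k + l + 2 * int u)) div 2) - v) else 0)"
    by (intro sum.cong refl sum_antidiagonal) (auto simp: M_def)
  also have "\<dots> = fls_nth (even_step (k + l) (\<lambda>m. \<Sum>u\<le>m. \<Sum>v\<le>m - u. ?F u v (m - u - v))) n"
  proof (cases "k + l \<le> n \<and> even (n - (k + l))")
    case True
    define m where "m = nat ((n - (k + l)) div 2)"
    have n: "n = k + l + 2 * int m" using True by (auto simp: m_def)
    have "m \<le> M" by (simp add: M_def n)
    have "(\<Sum>u\<le>M. if k + l + 2 * int u \<le> n \<and> even (n - (k + l + 2 * int u))
      then \<Sum>v\<le>nat ((n - (k + l + 2 * int u)) div 2). ?F u v (nat ((n - (k + l + 2 * int u)) div 2) - v) else 0)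
      = (\<Sum>u\<le>m. \<Sum>v\<le>m - u. ?F u v (m - u - v))"
    proof (rule sum.mono_neutral_cong_right, goal_cases)
      case (4 u)
      then have half: "nat ((n - (k + l + 2 * int u)) div 2) = m - u"
        and cond: "k + l + 2 * int u \<le> n \<and> even (n - (k + l + 2 * int u))"
        by (auto simp: n)
      show ?case unfolding if_P[OF cond] half ..
    qed (use \<open>m \<le> M\<close> in \<open>auto simp: n\<close>)
    then show ?thesis by (simp only: n even_step_nth_add)
  next
    case False
    then have "\<not> (k + l + 2 * int u \<le> n \<and> even (n - (k + l + 2 * int u)))" for u
      by auto
    then have "(\<Sum>u\<le>M. if k + l + 2 * int u \<le> n \<and> even (n - (k + l + 2 * int u))
      then \<Sum>v\<le>nat ((n - (k + l + 2 * int u)) div 2). ?F u v (nat ((n - (k + l + 2 * int u)) div 2) - v) else 0) = 0"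
      by (intro sum.neutral ballI) (simp only: if_False)
    then show ?thesis unfolding even_step_nth if_not_P[OF False] .
  qed
  finally show "fls_nth (sprod (even_step k \<alpha>) (even_step l \<beta>)) n
    = fls_nth (even_step (k + l) (\<lambda>m. \<Sum>u\<le>m. \<Sum>v\<le>m - u. ?F u v (m - u - v))) n" .
qed

text \<open>
  If \<open>e = q - r\<close> were nonzero with lowest term \<open>e_m y^m\<close>, then \<open>0 = q q - r r = q e + e r\<close> would have the
  coefficient \<open>2 r_p e_m\<close> at \<open>y^(p+m)\<close>, which is nonzero because 2 is invertible.
\<close>
lemma sprod_square_unique:
  assumes eq: "sprod q q = sprod r r"
    and q: "\<And>n. n < p \<Longrightarrow> fls_nth q n = 0" and r: "\<And>n. n < p \<Longrightarrow> fls_nth r n = 0"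
    and lead: "fls_nth q p = fls_nth r p" "fls_nth r p \<noteq> 0"
  shows "q = r"
proof (rule ccontr)
  assume "q \<noteq> r"
  define e where "e = q - r"
  have "e \<noteq> 0" using \<open>q \<noteq> r\<close> by (simp add: e_def)
  define m where "m = fls_subdegree e"
  have e: "\<And>n. n < m \<Longrightarrow> fls_nth e n = 0" by (simp add: m_def)
  have q_eq: "q = e + r" by (simp add: e_def)
  have "sprod q e + sprod e r = 0"
  proof -
    have "sprod q q = sprod q e + sprod q r"
      unfolding sprod_add_right[symmetric] q_eq ..
    also have "sprod q r = sprod e r + sprod r r"
      unfolding sprod_add_left[symmetric] q_eq ..
    finally show ?thesis using eq by (simp add: add.assoc[symmetric])
  qed
  then have "fls_nth (sprod q e) (p + m) + fls_nth (sprod e r) (m + p) = 0"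
    by (metis add.commute fls_plus_nth fls_zero_nth)
  moreover have "fls_nth (sprod q e) (p + m) = fls_nth q p * fls_nth e m"
    by (rule sprod_nth_lowest) (use q e in auto)
  moreover have "fls_nth (sprod e r) (m + p) = fls_nth e m * fls_nth r p"
    by (rule sprod_nth_lowest) (use r e in auto)
  ultimately have "fls_nth e m * (2 * fls_nth r p) = 0"
    by (simp add: lead algebra_simps)
  moreover have "(2::'a) \<noteq> 0"
  proof
    assume "(2::'a) = 0"
    then have "s (1 / 2 * of_nat 2) = 0"
      by (simp only: s_mult s_of_nat) simp
    then show False by simp
  qed
  ultimately have "fls_nth e m = 0" using lead by simp
  then show False using \<open>e \<noteq> 0\<close> by (simp add: m_def)
qed

end

section \<open>Powers of a unit\<close>

lemma unit_inv_right: "w dvd 1 \<Longrightarrow> w * unit_inv w = 1"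
  for w :: "'a::idom"
proof -
  assume "w dvd 1"
  then obtain v where v: "w * v = 1" by (metis dvdE)
  then have "w \<noteq> 0" by auto
  have "unit_inv w = v"
    unfolding unit_inv_def using v \<open>w \<noteq> 0\<close> by (intro the_equality) (auto simp flip: v)
  then show ?thesis using v by simp
qed

lemma unit_powi_0 [simp]: "unit_powi w 0 = 1"
  by (simp add: unit_powi_def)

lemma unit_powi_Suc:
  assumes "w dvd 1"
  shows "unit_powi w (m + 1) = w * unit_powi w m"
proof (cases "m \<ge> 0")
  case True
  then show ?thesis by (simp add: unit_powi_def nat_add_distrib)
next
  case False
  define n where "n = nat (- m - 1)"
  have m: "m = - int (Suc n)" using False by (simp add: n_def)
  have "w * unit_inv w ^ Suc n = unit_inv w ^ n"
    using unit_inv_right[OF assms] by (simp add: mult.assoc[symmetric])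
  then show ?thesis
    by (cases n) (simp_all add: m unit_powi_def nat_add_distrib)
qed

lemma unit_powi_add:
  assumes "w dvd 1"
  shows "unit_powi w (m + n) = unit_powi w m * unit_powi w n"
proof (induction m rule: int_induct[of _ 0])
  case (step1 i)
  then show ?case
    using unit_powi_Suc[OF assms, of "i + n"] unit_powi_Suc[OF assms, of i] by (simp add: ac_simps)
next
  case (step2 i)
  have "w \<noteq> 0" using assms by auto
  have "w * unit_powi w (i - 1 + n) = unit_powi w (i + n)"
    using unit_powi_Suc[OF assms, of "i - 1 + n"] by (simp add: algebra_simps)
  also have "\<dots> = unit_powi w i * unit_powi w n"
    by (rule step2)
  also have "unit_powi w i = w * unit_powi w (i - 1)"
    using unit_powi_Suc[OF assms, of "i - 1"] by simp
  finally show ?case using \<open>w \<noteq> 0\<close> by (simp add: mult.assoc)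
qed simp

lemma unit_powi_nonzero: "w dvd 1 \<Longrightarrow> unit_powi w m \<noteq> 0"
  using unit_powi_add[of w m "- m"] by auto

lemma unit_inv_power: "w dvd 1 \<Longrightarrow> unit_inv w ^ u = unit_powi w (- int u)"
  by (cases u) (simp_all add: unit_powi_def nat_add_distrib)

section \<open>The powers of the square root of x w^(-2)\<close>

text \<open>
  The unit \<open>w\<close> stands for \<open>c z + d\<close>: its derivative is \<open>c\<close>, and \<open>\<delta>\<close> is \<open>-1/2\<close> times the derivative.
\<close>
locale linear_unit = scalar_derivation +
  fixes w :: 'a and c :: complex
  assumes w_unit: "w dvd 1"
    and \<delta>_w: "\<delta> w = s (- (c / 2))"
begin

lemma w_nonzero: "w \<noteq> 0"
  using w_unit by auto

lemma \<delta>_unit_powi: "\<delta> (unit_powi w m) = s (- (of_int m * c / 2)) * unit_powi w (m - 1)"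
proof (induction m rule: int_induct[of _ 0])
  case base
  show ?case by simp
next
  case (step1 m)
  have "\<delta> (unit_powi w (m + 1)) = w * \<delta> (unit_powi w m) + \<delta> w * unit_powi w m"
    by (simp add: unit_powi_Suc[OF w_unit] \<delta>_mult)
  also have "\<dots> = s (- (of_int m * c / 2)) * (w * unit_powi w (m - 1)) + s (- (c / 2)) * unit_powi w m"
    by (simp add: step1 \<delta>_w ac_simps)
  also have "\<dots> = s (- (of_int m * c / 2) + - (c / 2)) * unit_powi w m"
    using unit_powi_Suc[OF w_unit, of "m - 1", symmetric]
    by (simp only: s_add distrib_right diff_add_cancel)
  also have "- (of_int m * c / 2) + - (c / 2) = - (of_int (m + 1) * c / 2)"
    by (simp add: field_simps)
  finally show ?case by simp
next
  case (step2 m)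
  have W: "unit_powi w m = w * unit_powi w (m - 1)" "unit_powi w (m - 1) = w * unit_powi w (m - 2)"
    using unit_powi_Suc[OF w_unit, of "m - 1"] unit_powi_Suc[OF w_unit, of "m - 2"] by simp_all
  have "w * \<delta> (unit_powi w (m - 1)) = \<delta> (unit_powi w m) - \<delta> w * unit_powi w (m - 1)"
    by (simp add: W(1) \<delta>_mult)
  also have "\<dots> = (s (- (of_int m * c / 2)) - s (- (c / 2))) * unit_powi w (m - 1)"
    by (simp add: step2 \<delta>_w ring_distribs)
  also have "s (- (of_int m * c / 2)) - s (- (c / 2)) = s (- (of_int (m - 1) * c / 2))"
    unfolding s_diff[symmetric] by (rule arg_cong[where f = s]) (simp add: field_simps)
  finally have "w * \<delta> (unit_powi w (m - 1)) = w * (s (- (of_int (m - 1) * c / 2)) * unit_powi w (m - 2))"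
    unfolding W(2) by (simp add: ac_simps)
  then show ?case using w_nonzero by simp
qed

lemma dpow_unit_powi:
  "(\<delta> ^^ j) (unit_powi w (- n))
    = s (pochhammer (of_int n) j * (c / 2) ^ j) * unit_powi w (- n - int j)"
proof (induction j)
  case (Suc j)
  have *: "- (of_int (- n - int j) * c / 2) = (of_int n + of_nat j) * (c / 2)"
    by (simp add: field_simps)
  have "\<delta> (unit_powi w (- n - int j))
      = s ((of_int n + of_nat j) * (c / 2)) * unit_powi w (- n - int (Suc j))"
    unfolding \<delta>_unit_powi * by (simp add: algebra_simps)
  then have "(\<delta> ^^ Suc j) (unit_powi w (- n))
      = s (pochhammer (of_int n) j * (c / 2) ^ j) * (s ((of_int n + of_nat j) * (c / 2))
        * unit_powi w (- n - int (Suc j)))"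
    by (simp only: funpow.simps o_apply Suc \<delta>_scale)
  also have "\<dots> = s (pochhammer (of_int n) (Suc j) * (c / 2) ^ Suc j) * unit_powi w (- n - int (Suc j))"
    by (simp only: pochhammer_Suc power_Suc s_mult ac_simps)
  finally show ?case .
qed simp

text \<open>
  The series that turns out to be \<open>(y^k|\<gamma>)\<close>.
\<close>
definition ypow :: "int \<Rightarrow> 'a fls" where
  "ypow k = even_step k (\<lambda>u. s (omega k u) * unit_powi w (- k) * (s c * unit_inv w) ^ u)"

text \<open>
  Collecting the powers of \<open>w\<close> makes \<open>\<delta>\<close> computable on the coefficients by \<open>dpow_unit_powi\<close>.
\<close>
lemma ypow_altdef: "ypow k = even_step k (\<lambda>u. s (omega k u * c ^ u) * unit_powi w (- k - int u))"
  unfolding ypow_def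
proof (rule even_step_eqI)
  fix u
  have "unit_powi w (- k - int u) = unit_powi w (- k) * unit_inv w ^ u"
    using unit_powi_add[OF w_unit, of "- k" "- int u"] by (simp add: unit_inv_power[OF w_unit])
  then show "s (omega k u) * unit_powi w (- k) * (s c * unit_inv w) ^ u
    = s (omega k u * c ^ u) * unit_powi w (- k - int u)"
    by (simp add: s_mult s_power power_mult_distrib ac_simps)
qed

lemma ypow_0: "ypow 0 = 1"
proof -
  have "ypow 0 = even_step 0 (\<lambda>u. if u = 0 then 1 else 0)"
    unfolding ypow_def by (rule even_step_eqI) (simp add: omega_0_left)
  then show ?thesis by (simp add: even_step_conv_shift fls_const_1)
qed

text \<open>
  All terms contributing to \<open>y^(k+l+2m)\<close> carry the same factor \<open>c^m w^(-(k+l)-m)\<close>, so only the numerical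
  identity \<open>omega_convolution\<close> remains.
\<close>
lemma ypow_add: "sprod (ypow k) (ypow l) = ypow (k + l)"
  unfolding ypow_altdef even_step_mult
proof (rule even_step_eqI)
  fix m
  let ?T = "\<lambda>u v. omega k u * omega l v * commcoeff (k + 2 * int u) (m - u - v)
      * (pochhammer (of_int l + of_nat v) (m - u - v) / 2 ^ (m - u - v))"
  have "(\<Sum>u\<le>m. \<Sum>v\<le>m - u. s (omega k u * c ^ u) * unit_powi w (- k - int u)
      * (s (commcoeff (k + 2 * int u) (m - u - v))
        * (\<delta> ^^ (m - u - v)) (s (omega l v * c ^ v) * unit_powi w (- l - int v))))
    = (\<Sum>u\<le>m. \<Sum>v\<le>m - u. s (?T u v) * (s (c ^ m) * unit_powi w (- (k + l) - int m)))"
  proof (intro sum.cong refl, goal_cases)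
    case (1 u v)
    define j where "j = m - u - v"
    have m: "m = u + v + j" using 1 by (simp add: j_def)
    have W: "unit_powi w (- k - int u) * unit_powi w (- (l + int v) - int j)
        = unit_powi w (- (k + l) - int m)"
      by (simp add: unit_powi_add[OF w_unit, symmetric] m algebra_simps)
    have D: "(\<delta> ^^ j) (unit_powi w (- l - int v)) = s (pochhammer (of_int (l + int v)) j * (c / 2) ^ j)
        * unit_powi w (- (l + int v) - int j)"
      using dpow_unit_powi[of j "l + int v"] by simp
    have "s (omega k u * c ^ u) * unit_powi w (- k - int u) * (s (commcoeff (k + 2 * int u) j)
        * (\<delta> ^^ j) (s (omega l v * c ^ v) * unit_powi w (- l - int v)))
      = s (omega k u * c ^ u) * s (commcoeff (k + 2 * int u) j) * s (omega l v * c ^ v)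
        * s (pochhammer (of_int (l + int v)) j * (c / 2) ^ j)
        * (unit_powi w (- k - int u) * unit_powi w (- (l + int v) - int j))"
      unfolding dpow_scale D by (simp only: ac_simps)
    also have "\<dots> = s (omega k u * omega l v * commcoeff (k + 2 * int u) j
        * (pochhammer (of_int l + of_nat v) j / 2 ^ j)) * s (c ^ m) * unit_powi w (- (k + l) - int m)"
      unfolding W by (simp add: s_mult[symmetric] m power_add power_divide ac_simps)
    finally show ?case by (simp only: j_def mult.assoc)
  qed
  also have "\<dots> = s (\<Sum>u\<le>m. \<Sum>v\<le>m - u. ?T u v) * (s (c ^ m) * unit_powi w (- (k + l) - int m))"
    by (simp only: s_sum sum_distrib_right)
  finally show "(\<Sum>u\<le>m. \<Sum>v\<le>m - u. s (omega k u * c ^ u) * unit_powi w (- k - int u)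
      * (s (commcoeff (k + 2 * int u) (m - u - v))
        * (\<delta> ^^ (m - u - v)) (s (omega l v * c ^ v) * unit_powi w (- l - int v))))
    = s (omega (k + l) m * c ^ m) * unit_powi w (- (k + l) - int m)"
    unfolding omega_convolution by (simp only: s_mult mult.assoc)
qed

text \<open>
  Here \<open>x w^(-2) = \<Sum>m. 2^m \<delta>^m(w^(-2)) y^(2m+2)\<close>, and \<open>2^m \<delta>^m(w^(-2)) = (m+1)! c^m w^(-2-m)\<close>, where
  \<open>(m+1)! = \<omega>_2(m)\<close>.
\<close>
lemma ypow_2: "ypow 2 = sprod (sprod fls_X fls_X) (fls_const (unit_powi w (- 2)))"
proof -
  have X2: "sprod fls_X fls_X = even_step 2 (\<lambda>u. if u = 0 then 1 else 0)"
    using sprod_X_intpow[of 1 1] by (simp add: fls_X_conv_shift_1 even_step_conv_shift fls_const_1)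
  have const: "fls_const (unit_powi w (- 2)) = even_step 0 (\<lambda>u. if u = 0 then unit_powi w (- 2) else 0)"
    by (simp add: even_step_conv_shift)
  show ?thesis unfolding X2 const even_step_mult unfolding ypow_altdef add_0_right
  proof (rule even_step_eqI)
    fix m
    let ?X = "\<lambda>u v. s (commcoeff (2 + 2 * int u) (m - u - v))
        * (\<delta> ^^ (m - u - v)) (if v = 0 then unit_powi w (- 2) else 0)"
    have "(\<Sum>u\<le>m. \<Sum>v\<le>m - u. (if u = 0 then 1 else 0) * ?X u v)
        = (\<Sum>u\<le>m. if u = 0 then \<Sum>v\<le>m. ?X 0 v else 0)"
      by (intro sum.cong refl) auto
    also have "\<dots> = (\<Sum>v\<le>m. ?X 0 v)"
      by (simp add: sum.delta)
    also have "\<dots> = (\<Sum>v\<le>m. if v = 0 then s (commcoeff 2 m) * (\<delta> ^^ m) (unit_powi w (- 2)) else 0)"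
      by (intro sum.cong refl) auto
    also have "\<dots> = s (commcoeff 2 m) * (\<delta> ^^ m) (unit_powi w (- 2))"
      by (simp add: sum.delta)
    also have "\<dots> = s (commcoeff 2 m * (pochhammer 2 m * (c / 2) ^ m)) * unit_powi w (- 2 - int m)"
      using dpow_unit_powi[of m 2] by (simp add: s_mult)
    also have "commcoeff 2 m * (pochhammer 2 m * (c / 2) ^ m) = omega 2 m * c ^ m"
      by (simp add: commcoeff_2 omega_pochhammer power_divide flip: pochhammer_fact)
    finally show "s (omega 2 m * c ^ m) * unit_powi w (- 2 - int m) =
      (\<Sum>u\<le>m. \<Sum>v\<le>m - u. (if u = 0 then 1 else 0) * (s (commcoeff (2 + 2 * int u) (m - u - v))
        * (\<delta> ^^ (m - u - v)) (if v = 0 then unit_powi w (- 2) else 0)))" ..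
  qed
qed

lemma ypow_nth_below: "n < k \<Longrightarrow> fls_nth (ypow k) n = 0"
  by (simp add: ypow_def even_step_nth_below)

lemma ypow_nth_lowest: "fls_nth (ypow k) k = unit_powi w (- k)"
  using even_step_nth_add[of k _ 0] by (simp add: ypow_def)

lemma ypow_1_unique:
  "(THE q. sprod q q = sprod (sprod fls_X fls_X) (fls_const (unit_powi w (- 2)))
     \<and> fls_subdegree q = 1 \<and> fls_nth q 1 = unit_powi w (- 1)) = ypow 1"
proof (rule the_equality, goal_cases)
  case 1
  have "fls_subdegree (ypow 1) = 1"
    by (rule fls_subdegree_eqI)
      (simp_all add: ypow_nth_lowest ypow_nth_below unit_powi_nonzero[OF w_unit])
  then show ?case
    using ypow_add[of 1 1] by (simp add: ypow_2 ypow_nth_lowest)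
next
  case (2 q)
  then have "sprod q q = sprod (ypow 1) (ypow 1)"
    using ypow_add[of 1 1] by (simp add: ypow_2)
  then show ?case
    by (rule sprod_square_unique[where p = 1])
      (use 2 in \<open>auto simp: ypow_nth_below ypow_nth_lowest unit_powi_nonzero[OF w_unit]\<close>)
qed

end

section \<open>Integer powers and convergence\<close>

text \<open>
  The inverse of \<open>\<phi> m\<close> is \<open>\<phi> (- m)\<close>, so negative powers of \<open>\<phi> 1\<close> are determined even though \<open>G\<close> need
  not be a group.
\<close>
lemma (in monoid) int_pow_of_int_hom:
  assumes closed: "\<And>m :: int. \<phi> m \<in> carrier G" and zero: "\<phi> 0 = \<one>"
    and add: "\<And>m n. \<phi> (m + n) = \<phi> m \<otimes> \<phi> n"
  shows "\<phi> 1 [^] k = \<phi> k"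
proof -
  have nat_pow: "\<phi> 1 [^] n = \<phi> (int n)" for n :: nat
  proof (induction n)
    case (Suc n)
    have "\<phi> 1 [^] Suc n = \<phi> (int n) \<otimes> \<phi> 1"
      unfolding nat_pow_Suc Suc ..
    also have "\<dots> = \<phi> (int n + 1)"
      by (rule add[symmetric])
    finally show ?case by (simp only: of_nat_Suc add.commute)
  qed (simp only: nat_pow_0 zero of_nat_0)
  have inverse: "inv (\<phi> m) = \<phi> (- m)" for m
  proof -
    have "\<phi> m \<otimes> \<phi> (- m) = \<one>" "\<phi> (- m) \<otimes> \<phi> m = \<one>"
      unfolding add[symmetric] using zero by simp_all
    then show ?thesis
      using inv_unique'[OF closed closed] by metis
  qed
  show ?thesis
  proof (cases "k < 0")
    case True
    then show ?thesis
      unfolding int_pow_def2 nat_pow inverse by simp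
  next
    case False
    then show ?thesis
      unfolding int_pow_def2 nat_pow by simp
  qed
qed

text \<open>
  The distance of two Laurent series is \<open>2^(-v)\<close>, where \<open>v\<close> is the valuation of their difference.
\<close>
lemma fls_LIMSEQ_I:
  fixes f :: "'a::group_add fls"
  assumes "\<And>n i. i < k + int n \<Longrightarrow> fls_nth (F n) i = fls_nth f i"
  shows "F \<longlonglongrightarrow> f"
proof (rule metric_LIMSEQ_I)
  fix r :: real
  assume "0 < r"
  then obtain N where N: "inverse (2 ^ N) < r"
    using real_arch_pow_inv[of r "1 / 2"] by (auto simp: power_one_over field_simps)
  show "\<exists>no. \<forall>n\<ge>no. dist (F n) f < r"
  proof (intro exI allI impI)
    fix n assume n: "nat (int N - k) \<le> n"
    show "dist (F n) f < r"
    proof (cases "F n = f")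
      case False
      have "int N \<le> fls_subdegree (F n - f)"
        using False n assms by (intro fls_subdegree_geI) auto
      then have "dist (F n) f = inverse (2 ^ nat (fls_subdegree (F n - f)))"
        and "N \<le> nat (fls_subdegree (F n - f))"
        using False by (auto simp: dist_fls_def)
      then have "dist (F n) f \<le> inverse (2 ^ N)"
        by (simp add: power_increasing)
      then show ?thesis using N by simp
    qed (use \<open>0 < r\<close> in simp)
  qed
qed

lemma (in scalar_derivation) even_step_sums:
  "(\<lambda>u. fls_shift (- (2 * int u + k)) (fls_const (\<alpha> u))) sums even_step k \<alpha>"
  unfolding sums_def
proof (rule fls_LIMSEQ_I)
  fix N :: nat and n
  assume n: "n < k + int N"
  show "fls_nth (\<Sum>u<N. fls_shift (- (2 * int u + k)) (fls_const (\<alpha> u))) n = fls_nth (even_step k \<alpha>) n"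
  proof (cases "k \<le> n \<and> even (n - k)")
    case True
    define m where "m = nat ((n - k) div 2)"
    have m: "n = k + 2 * int m" using True by (auto simp: m_def)
    have "(\<Sum>u<N. fls_nth (fls_shift (- (2 * int u + k)) (fls_const (\<alpha> u))) n)
        = (\<Sum>u<N. if u = m then \<alpha> u else 0)"
      unfolding fls_monomial_nth by (intro sum.cong) (auto simp: m)
    also have "\<dots> = \<alpha> m"
      using n by (simp add: m sum.delta)
    finally show ?thesis by (simp only: fls_nth_sum m even_step_nth_add)
  next
    case False
    then have "n \<noteq> 2 * int u + k" for u by auto
    then show ?thesis
      using False by (simp only: fls_nth_sum fls_monomial_nth even_step_nth) simp
  qed
qed

section \<open>Generic equality of functions\<close>

text \<open>
  Packaging generic validity as a filter makes the combination of generically valid identities a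
  matter of \<open>eventually_elim\<close>.
\<close>
definition generic_filter :: "complex set \<Rightarrow> complex filter" where
  "generic_filter D = Abs_filter (generically D)"

lemma generically_conj:
  assumes "generically D P" "generically D Q"
  shows "generically D (\<lambda>z. P z \<and> Q z)"
proof -
  obtain U where U: "open U" "U \<subseteq> D" "D \<subseteq> closure U" "\<forall>z\<in>U. P z"
    using assms(1) by (auto simp: generically_def)
  obtain V where V: "open V" "V \<subseteq> D" "D \<subseteq> closure V" "\<forall>z\<in>V. Q z"
    using assms(2) by (auto simp: generically_def)
  have "U \<subseteq> closure (U \<inter> V)"
    using open_Int_closure_subset[OF U(1), of V] U V by blast
  then have "closure U \<subseteq> closure (U \<inter> V)"
    using closure_mono[of U "closure (U \<inter> V)"] by simp
  then show ?thesis
    unfolding generically_def using U V by (intro exI[of _ "U \<inter> V"]) auto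
qed

lemma eventually_generic:
  assumes "open D"
  shows "eventually P (generic_filter D) \<longleftrightarrow> generically D P"
  unfolding generic_filter_def
proof (rule eventually_Abs_filter, rule is_filter.intro)
  show "generically D (\<lambda>_. True)"
    unfolding generically_def using assms closure_subset by blast
  show "generically D (\<lambda>z. P z \<and> Q z)" if "generically D P" "generically D Q" for P Q
    using that by (rule generically_conj)
  show "generically D Q" if "\<forall>z. P z \<longrightarrow> Q z" "generically D P" for P Q
    using that unfolding generically_def by blast
qed

text \<open>
  Generic equality holds near every point of an open set, so it passes to derivatives.
\<close>
lemma eventually_generic_deriv:
  assumes D: "open D" and eq: "\<forall>\<^sub>F z in generic_filter D. g z = h z"
  shows "\<forall>\<^sub>F z in generic_filter D. deriv g z = deriv h z"
proof -
  obtain U where U: "open U" "U \<subseteq> D" "D \<subseteq> closure U" and gh: "\<forall>z\<in>U. g z = h z"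
    using eq by (auto simp: eventually_generic[OF D] generically_def)
  have "deriv g z = deriv h z" if "z \<in> U" for z
  proof (rule deriv_cong_ev)
    show "\<forall>\<^sub>F x in nhds z. g x = h x"
      using U(1) that gh by (auto simp: eventually_nhds)
  qed simp
  then show ?thesis
    unfolding eventually_generic[OF D] generically_def using U by blast
qed

text \<open>
  Away from its pole a homography is a homeomorphism onto an open set, the inverse being
  \<open>w \<mapsto> (d w - b) / (a - c w)\<close>. It therefore maps a small open set near any point of \<open>D\<close> other than the
  pole to an open set meeting the given dense open set. Removing the pole from \<open>D\<close> leaves a dense
  subset, because finite sets have empty interior.
\<close>
lemma eventually_generic_homography:
  assumes D: "open D" and det: "det \<gamma> = 1"
    and maps: "\<And>z. z \<in> D \<Longrightarrow> \<gamma>$2$1 * z + \<gamma>$2$2 \<noteq> 0 \<Longrightarrow> homography \<gamma> z \<in> D"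
    and P: "\<forall>\<^sub>F z in generic_filter D. P z"
  shows "\<forall>\<^sub>F z in generic_filter D. P (homography \<gamma> z)"
proof -
  define a b c d where "a = \<gamma>$1$1" and "b = \<gamma>$1$2" and "c = \<gamma>$2$1" and "d = \<gamma>$2$2"
  have det: "a * d - b * c = 1"
    using det by (simp add: det_2 a_def b_def c_def d_def)
  have hom: "homography \<gamma> z = (a * z + b) / (c * z + d)" for z
    by (simp add: homography_def a_def b_def c_def d_def)
  obtain U where U: "open U" "U \<subseteq> D" "D \<subseteq> closure U" and PU: "\<forall>z\<in>U. P z"
    using P by (auto simp: eventually_generic[OF D] generically_def)
  define E where "E = D \<inter> - {z. c * z + d = 0}"
  have cont: "continuous_on E (homography \<gamma>)"
    unfolding hom by (intro continuous_intros) (auto simp: E_def)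
  have "finite {z. c * z + d = 0}"
  proof (cases "c = 0")
    case True
    then have "d \<noteq> 0" using det by auto
    with True show ?thesis by simp
  next
    case False
    have "z = - d / c" if "c * z + d = 0" for z
    proof -
      from that have "c * z = - d" by (simp only: eq_neg_iff_add_eq_0)
      then show ?thesis using False by (metis nonzero_mult_div_cancel_left)
    qed
    then have "{z. c * z + d = 0} \<subseteq> {- d / c}"
      by blast
    then show ?thesis by (rule finite_subset) simp
  qed
  then have "open (- {z. c * z + d = 0})" and "closure (- {z. c * z + d = 0}) = UNIV"
    by (simp_all add: closure_complement empty_interior_finite finite_imp_closed open_Compl
        del: Collect_neg_eq)
  then have "open E" and "D \<subseteq> closure E"
    using D open_Int_closure_subset[OF D, of "- {z. c * z + d = 0}"]
    unfolding E_def by (simp_all only: open_Int Int_UNIV_right)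
  define V where "V = E \<inter> homography \<gamma> -` U"
  have "open V"
    unfolding V_def using cont \<open>open E\<close> U(1) by (rule continuous_open_preimage)
  have "E \<subseteq> closure V"
  proof
    fix z assume z: "z \<in> E"
    have "V \<inter> W \<noteq> {}" if W: "open W" "z \<in> W" for W
    proof -
      let ?G = "\<lambda>w. (d * w - b) / (a - c * w)"
      have image: "homography \<gamma> ` (W \<inter> E) = {w. a - c * w \<noteq> 0} \<inter> ?G -` (W \<inter> E)"
      proof (intro equalityI subsetI)
        fix w assume "w \<in> homography \<gamma> ` (W \<inter> E)"
        then obtain x where x: "x \<in> W \<inter> E" "w = (a * x + b) / (c * x + d)"
          by (auto simp: hom)
        then have nz: "c * x + d \<noteq> 0" by (auto simp: E_def)
        have "a - c * w = (a * d - b * c) / (c * x + d)"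
          using nz by (simp add: x(2) field_simps)
        moreover have "d * w - b = (a * d - b * c) * x / (c * x + d)"
          using nz by (simp add: x(2) field_simps)
        ultimately have "a - c * w \<noteq> 0" "?G w = x"
          using nz by (simp_all add: det)
        then show "w \<in> {w. a - c * w \<noteq> 0} \<inter> ?G -` (W \<inter> E)"
          using x(1) by simp
      next
        fix w assume w: "w \<in> {w. a - c * w \<noteq> 0} \<inter> ?G -` (W \<inter> E)"
        then have nz: "a - c * w \<noteq> 0" by simp
        have "c * ?G w + d = (a * d - b * c) / (a - c * w)"
          using nz by (simp add: field_simps)
        moreover have "a * ?G w + b = (a * d - b * c) * w / (a - c * w)"
          using nz by (simp add: field_simps)
        ultimately have "homography \<gamma> (?G w) = w"
          using nz by (simp add: hom det)
        then show "w \<in> homography \<gamma> ` (W \<inter> E)"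
          using w by (intro image_eqI[where x = "?G w"]) auto
      qed
      have "open {w. a - c * w \<noteq> 0}"
        by (intro open_Collect_neq continuous_intros)
      moreover have "continuous_on {w. a - c * w \<noteq> 0} ?G"
        by (intro continuous_intros) auto
      ultimately have "open (homography \<gamma> ` (W \<inter> E))"
        unfolding image using W(1) \<open>open E\<close> by (intro continuous_open_preimage) auto
      moreover have "homography \<gamma> z \<in> homography \<gamma> ` (W \<inter> E)"
        using W z by auto
      moreover have "homography \<gamma> z \<in> closure U"
        using z maps U(3) by (auto simp: E_def c_def d_def)
      ultimately have "U \<inter> homography \<gamma> ` (W \<inter> E) \<noteq> {}"
        using open_Int_closure_eq_empty[of "homography \<gamma> ` (W \<inter> E)" U] by blast
      then show ?thesis by (auto simp: V_def)
    qed
    then show "z \<in> closure V"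
      unfolding closure_iff_nhds_not_empty by blast
  qed
  then have "D \<subseteq> closure V"
    using \<open>D \<subseteq> closure E\<close> closure_mono[of E "closure V"] by simp
  then show ?thesis
    unfolding eventually_generic[OF D] generically_def
    using \<open>open V\<close> PU by (intro exI[of _ V]) (auto simp: V_def E_def)
qed

section \<open>The algebra of functions\<close>

context homographic_algebra begin

abbreviation gen :: "complex filter" where
  "gen \<equiv> generic_filter D"

lemmas gen_iff = eventually_generic[OF open_D]

lemma ev_eqI: "\<forall>\<^sub>F z in gen. ev f z = ev g z \<Longrightarrow> f = g"
  using ev_inject by (simp add: gen_iff)

lemma elt_eqI: "\<forall>\<^sub>F z in gen. ev f z = h z \<Longrightarrow> elt D ev h = f"
  unfolding elt_def gen_iff[symmetric]
proof (rule the_equality)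
  fix g assume "\<forall>\<^sub>F z in gen. ev f z = h z" "\<forall>\<^sub>F z in gen. ev g z = h z"
  then have "\<forall>\<^sub>F z in gen. ev g z = ev f z"
    by eventually_elim simp
  then show "g = f" by (rule ev_eqI)
qed

lemma ev_elt: "is_elt D ev h \<Longrightarrow> \<forall>\<^sub>F z in gen. ev (elt D ev h) z = h z"
  unfolding is_elt_def gen_iff[symmetric] using elt_eqI by auto

lemma gen_add: "\<forall>\<^sub>F z in gen. ev (f + g) z = ev f z + ev g z"
  using ev_add by (simp add: gen_iff)

lemma gen_mult: "\<forall>\<^sub>F z in gen. ev (f * g) z = ev f z * ev g z"
  using ev_mult by (simp add: gen_iff)

lemma gen_differentiable: "\<forall>\<^sub>F z in gen. ev f field_differentiable at z"
  using ev_differentiable by (simp add: gen_iff)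

lemma gen_scal: "\<forall>\<^sub>F z in gen. ev (scal D ev a) z = a"
  unfolding scal_def by (rule ev_elt[OF is_elt_const])

lemma gen_pderiv: "\<forall>\<^sub>F z in gen. ev (pderiv_z D ev f) z = deriv (ev f) z"
  unfolding pderiv_z_def by (rule ev_elt[OF is_elt_deriv])

lemma gen_0: "\<forall>\<^sub>F z in gen. ev 0 z = 0"
  using gen_add[of 0 0] by eventually_elim simp

text \<open>
  Multiplication by the constant function 1, whose values are known, shows that the unit of the
  algebra has value 1 as well.
\<close>
lemma gen_1: "\<forall>\<^sub>F z in gen. ev 1 z = 1"
  using gen_mult[of 1 "scal D ev 1"] gen_scal[of 1] by eventually_elim simp

lemma scal_add: "scal D ev (a + b) = scal D ev a + scal D ev b"
  by (rule ev_eqI, use gen_add[of "scal D ev a" "scal D ev b"] gen_scal[of a] gen_scal[of b] gen_scal[of "a + b"] in eventually_elim)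
    simp

lemma scal_mult: "scal D ev (a * b) = scal D ev a * scal D ev b"
  by (rule ev_eqI, use gen_mult[of "scal D ev a" "scal D ev b"] gen_scal[of a] gen_scal[of b] gen_scal[of "a * b"] in eventually_elim)
    simp

lemma scal_1: "scal D ev 1 = 1"
  by (rule ev_eqI, use gen_1 gen_scal[of 1] in eventually_elim) simp

lemma pderiv_add: "pderiv_z D ev (f + g) = pderiv_z D ev f + pderiv_z D ev g"
proof (rule ev_eqI)
  show "\<forall>\<^sub>F z in gen. ev (pderiv_z D ev (f + g)) z = ev (pderiv_z D ev f + pderiv_z D ev g) z"
    using gen_pderiv[of "f + g"] gen_pderiv[of f] gen_pderiv[of g]
      eventually_generic_deriv[OF open_D gen_add[of f g]]
      gen_differentiable[of f] gen_differentiable[of g]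
      gen_add[of "pderiv_z D ev f" "pderiv_z D ev g"]
    by eventually_elim simp
qed

lemma pderiv_mult: "pderiv_z D ev (f * g) = f * pderiv_z D ev g + pderiv_z D ev f * g"
proof (rule ev_eqI)
  show "\<forall>\<^sub>F z in gen. ev (pderiv_z D ev (f * g)) z = ev (f * pderiv_z D ev g + pderiv_z D ev f * g) z"
    using gen_pderiv[of "f * g"] gen_pderiv[of f] gen_pderiv[of g]
      eventually_generic_deriv[OF open_D gen_mult[of f g]]
      gen_differentiable[of f] gen_differentiable[of g]
      gen_add[of "f * pderiv_z D ev g" "pderiv_z D ev f * g"]
      gen_mult[of f "pderiv_z D ev g"] gen_mult[of "pderiv_z D ev f" g]
    by eventually_elim simp
qed

lemma pderiv_scal: "pderiv_z D ev (scal D ev a) = 0"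
proof (rule ev_eqI)
  show "\<forall>\<^sub>F z in gen. ev (pderiv_z D ev (scal D ev a)) z = ev 0 z"
    using gen_pderiv[of "scal D ev a"] eventually_generic_deriv[OF open_D gen_scal[of a]] gen_0
    by eventually_elim simp
qed

lemma pderiv_autf:
  assumes "\<gamma> \<in> \<Gamma>"
  shows "pderiv_z D ev (autf D ev \<gamma>) = scal D ev (\<gamma>$2$1)"
proof (rule ev_eqI)
  have "\<forall>\<^sub>F z in gen. ev (autf D ev \<gamma>) z = \<gamma>$2$1 * z + \<gamma>$2$2"
    unfolding autf_def by (rule ev_elt[OF is_elt_autf[OF assms]])
  from gen_pderiv[of "autf D ev \<gamma>"] eventually_generic_deriv[OF open_D this]
    gen_scal[of "\<gamma>$2$1"]
  show "\<forall>\<^sub>F z in gen. ev (pderiv_z D ev (autf D ev \<gamma>)) z = ev (scal D ev (\<gamma>$2$1)) z"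
  proof eventually_elim
    case (elim z)
    have "deriv (\<lambda>z. \<gamma>$2$1 * z + \<gamma>$2$2) z = \<gamma>$2$1"
      by (rule DERIV_imp_deriv) (auto intro!: derivative_eq_intros)
    with elim show ?case by simp
  qed
qed

lemma det_\<Gamma>: "\<gamma> \<in> \<Gamma> \<Longrightarrow> det \<gamma> = 1"
  using subgroup.subset[OF subgroup_\<Gamma>] by (auto simp: SL2C_def)

text \<open>
  Stated for an element whose values are generically constant, so that it applies to the zero and to
  the unit of the algebra.
\<close>
lemma act_constant:
  assumes \<gamma>: "\<gamma> \<in> \<Gamma>" and f: "\<forall>\<^sub>F z in gen. ev f z = a"
  shows "act D ev f \<gamma> = f"
  unfolding act_def
proof (rule elt_eqI)
  have "\<forall>\<^sub>F z in gen. ev f (homography \<gamma> z) = a"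
    by (rule eventually_generic_homography[OF open_D det_\<Gamma>[OF \<gamma>] homography_D[OF \<gamma>] f])
  with f show "\<forall>\<^sub>F z in gen. ev f z = ev f (homography \<gamma> z)"
    by eventually_elim simp
qed

end

sublocale homographic_algebra \<subseteq> skew: scalar_derivation "scal D ev" "delta_z D ev"
proof
  show "scal D ev (a + b) = scal D ev a + scal D ev b" for a b
    by (rule scal_add)
  show "scal D ev (a * b) = scal D ev a * scal D ev b" for a b
    by (rule scal_mult)
  show "scal D ev 1 = 1"
    by (rule scal_1)
  show "delta_z D ev (f + g) = delta_z D ev f + delta_z D ev g" for f g
    by (simp only: delta_z_def pderiv_add minus_add_distrib distrib_left)
  show "delta_z D ev (f * g) = f * delta_z D ev g + delta_z D ev f * g" for f g
    by (simp add: delta_z_def pderiv_mult ring_distribs ac_simps)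
  show "delta_z D ev (scal D ev a) = 0" for a
    by (simp add: delta_z_def pderiv_scal)
qed

context homographic_algebra begin

lemma linear_unit_autf:
  assumes "\<gamma> \<in> \<Gamma>"
  shows "linear_unit (scal D ev) (delta_z D ev) (autf D ev \<gamma>) (\<gamma>$2$1)"
proof unfold_locales
  show "autf D ev \<gamma> dvd 1"
    by (rule autf_unit[OF assms])
  have "scal D ev (1 / 2) * - scal D ev (\<gamma>$2$1) = scal D ev (1 / 2 * - (\<gamma>$2$1))"
    by (simp only: scal_mult skew.s_minus)
  then show "delta_z D ev (autf D ev \<gamma>) = scal D ev (- (\<gamma>$2$1 / 2))"
    by (simp add: delta_z_def pderiv_autf[OF assms])
qed

lemma lmult_y_eq: "lmult_y D ev = skew.sprod fls_X"
  by (rule ext) (simp only: lmult_y_def skew.lmult_X)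

text \<open>
  Both products are \<open>\<Sum>i. f_i (y^i g)\<close>; the integer iterates of left multiplication by \<open>y\<close> are left
  multiplications by \<open>y^i\<close> by associativity of \<open>sprod\<close>.
\<close>
lemma skew_mult_eq: "skew_mult D ev = skew.sprod"
proof (intro ext)
  fix f g
  have "lmult_y_powi D ev i g = skew.sprod (fls_X_intpow i) g" for i
    unfolding lmult_y_powi_def lmult_y_eq by (rule skew.sprod_X_funpow_int)
  then show "skew_mult D ev f g = skew.sprod f g"
    unfolding skew.sprod_altdef[of f g] by (simp only: skew_mult_def)
qed

lemma mult_skew_laurent: "mult (skew_laurent D ev) = skew.sprod"
  by (simp add: skew_laurent_def skew_mult_eq)

lemma monoid_skew_laurent: "monoid (skew_laurent D ev)"
  by unfold_locales (simp_all add: mult_skew_laurent, simp_all add: skew_laurent_def skew.sprod_assoc)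

lemma X_int_pow: "fls_X [^]\<^bsub>skew_laurent D ev\<^esub> (k :: int) = fls_X_intpow k"
proof -
  interpret C: monoid "skew_laurent D ev" by (rule monoid_skew_laurent)
  have "fls_X_intpow 1 [^]\<^bsub>skew_laurent D ev\<^esub> k = fls_X_intpow k"
    by (rule C.int_pow_of_int_hom)
      (simp_all add: mult_skew_laurent skew.sprod_X_intpow, simp_all add: skew_laurent_def)
  then show ?thesis by (simp add: fls_X_conv_shift_1)
qed

end

text \<open>
  The coefficients of the series \<open>y^k\<close> are 0 and 1, both fixed by \<open>\<gamma>\<close>, so \<open>(y^k|\<gamma>)\<close> is the single term
  \<open>(y|\<gamma>)^k\<close>.
\<close>
theorem theorem2p2p5:
  fixes D :: "complex set"
    and ev :: "'a::idom \<Rightarrow> complex \<Rightarrow> complex"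
    and \<Gamma> :: "(complex^2^2) set"
    and \<gamma> :: "complex^2^2"
    and k :: int
  assumes "homographic_algebra D ev \<Gamma>"
    and "\<gamma> \<in> \<Gamma>"
  shows "(\<lambda>u. fls_const (scal D ev (omega k u) * unit_powi (autf D ev \<gamma>) (- k)
              * (scal D ev (\<gamma>$2$1) * unit_inv (autf D ev \<gamma>)) ^ u)
            \<otimes>\<^bsub>skew_laurent D ev\<^esub> (fls_X [^]\<^bsub>skew_laurent D ev\<^esub> (2 * int u + k)))
         sums series_act D ev (fls_X [^]\<^bsub>skew_laurent D ev\<^esub> k) \<gamma>"
proof -
  interpret homographic_algebra D ev \<Gamma> by fact
  interpret lin: linear_unit "scal D ev" "delta_z D ev" "autf D ev \<gamma>" "\<gamma>$2$1"
    by (rule linear_unit_autf) fact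
  interpret C: monoid "skew_laurent D ev" by (rule monoid_skew_laurent)
  have yact: "yact D ev \<gamma> = lin.ypow 1"
    unfolding yact_def mult_skew_laurent by (rule lin.ypow_1_unique)
  have yact_pow: "yact D ev \<gamma> [^]\<^bsub>skew_laurent D ev\<^esub> n = lin.ypow n" for n :: int
    unfolding yact
    by (rule C.int_pow_of_int_hom)
      (simp_all add: mult_skew_laurent lin.ypow_add, simp_all add: skew_laurent_def lin.ypow_0)
  have act: "act D ev 0 \<gamma> = 0" "act D ev 1 \<gamma> = 1"
    using act_constant[OF \<open>\<gamma> \<in> \<Gamma>\<close>] gen_0 gen_1 by blast+
  have "series_act D ev (fls_X_intpow k) \<gamma> = lin.ypow k"
  proof -
    have "(\<Sum>n = k..m. fls_nth (skew.sprod (fls_const (act D ev (fls_nth (fls_X_intpow k) n) \<gamma>))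
        (lin.ypow n)) m) = fls_nth (lin.ypow k) m" for m
    proof -
      have "(\<Sum>n = k..m. fls_nth (skew.sprod (fls_const (act D ev (fls_nth (fls_X_intpow k) n) \<gamma>))
        (lin.ypow n)) m) = (\<Sum>n = k..m. if n = k then fls_nth (lin.ypow k) m else 0)"
        unfolding skew.sprod_const_left_nth by (intro sum.cong) (auto simp: act)
      then show ?thesis
        by (simp add: sum.delta lin.ypow_nth_below)
    qed
    then show ?thesis
      unfolding series_act_def mult_skew_laurent yact_pow fls_subdegree_fls_X_intpow
      by (simp only: fls_nth_inverse)
  qed
  then show ?thesis
    unfolding mult_skew_laurent X_int_pow skew.sprod_const_X_intpow
    using skew.even_step_sums[of k] by (simp only: lin.ypow_def)
qed

end
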